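(* Let $r\ge 2$ be a fixed integer. There exists a constant $C_r$ such that the following holds. Suppose that $p_1,\dots,p_r$ are functions of $n$ such that $0\le p_1\le p_2\le\dots\le p_r\le 1$, and let $\mathbf{G}=\mathbf{G}(n,p_1,p_2,\dots,p_r)$ be the $r$-fold binomial random graph. For $i\in[r]$ let $P_i:=p_1p_2\cdots p_i$. Then: (i) if $P_i\le \frac{1}{C_r\, n(\ln n)^{i-1}}$ for some $2\le i\le r$, or $P_1\le \frac{\ln n}{C_r n}$, then with high probability $\mathbf{G}$ does not percolate; (ii) if $P_i\ge \frac{C_r}{n(\ln n)^{i-1}}$ for every $2\le i\le r$, and $P_1\ge \frac{C_r\ln n}{n}$, then with high probability $\mathbf{G}$ percolates.
   Context: Write $[n]=\{1,\dots,n\}$. An $r$-fold graph is an $(r+1)$-tuple $\mathbf{G}=(V,E_1,\dots,E_r)$ where $V=[n]$ is the vertex set and $E_i\subseteq\binom{V}{2}$ for each $i\in[r]$; the graph $(V,E_i)$ is the graph of colour $i$. The $r$-fold binomial random graph $\mathbf{G}(n,p_1,\dots,p_r)$ is the random $r$-fold graph $([n],E_1,\dots,E_r)$ where $([n],E_i)\sim G(n,p_i)$, $i\in[r]$, are independent binomial (Erdős–Rényi) random graphs. Multi-coloured jigsaw algorithm on an $r$-fold graph $(V,E_1,\dots,E_r)$: start with the partition $\mathcal{C}_0$ of $V$ into singletons (clusters). Given the partition $\mathcal{C}_t$ at time $t\ge0$, let $H_t$ be the graph with vertex set $\mathcal{C}_t$ in which two distinct clusters $C,C'$ are joined if for every colour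 $s\in[r]$ there is an edge of $E_s$ with one endpoint in $C$ and the other in $C'$. If $H_t$ has no edges, stop. Otherwise $\mathcal{C}_{t+1}$ is obtained by merging all the clusters in each connected component of $H_t$ into one cluster. If $|\mathcal{C}_{t+1}|=1$, stop; otherwise continue. The $r$-fold graph percolates if the algorithm ends with one single cluster, and does not percolate otherwise. "With high probability" means with probability tending to $1$ as $n\to\infty$. *)

theory Defs
  imports "HOL-Probability.Probability"
begin

text \<open>
  An \<open>r\<close>-fold graph is a pair \<open>(V, E)\<close>, where \<open>E i\<close> is the edge set of colour \<open>i\<close> for
  \<open>i \<in> {1..r}\<close>. By convention \<open>E i = {}\<close> for all other \<open>i\<close>; the number \<open>r\<close> of colours
  is passed as a separate argument.
\<close>

type_synonym 'v fold_graph = "'v set \<times> (nat \<Rightarrow> 'v set set)"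

definition vertex_pairs :: "'v set \<Rightarrow> 'v set set" where
  "vertex_pairs V = {e. e \<subseteq> V \<and> card e = 2}"

definition is_fold_graph :: "nat \<Rightarrow> 'v fold_graph \<Rightarrow> bool" where
  "is_fold_graph r G \<longleftrightarrow>
     (\<forall>i\<in>{1..r}. snd G i \<subseteq> vertex_pairs (fst G)) \<and> (\<forall>i. i \<notin> {1..r} \<longrightarrow> snd G i = {})"


subsection \<open>The multi-coloured jigsaw algorithm\<close>

definition cluster_graph :: "nat \<Rightarrow> 'v fold_graph \<Rightarrow> 'v set set \<Rightarrow> ('v set \<times> 'v set) set" where
  "cluster_graph r G \<C> =
     {(C, C'). C \<in> \<C> \<and> C' \<in> \<C> \<and> C \<noteq> C' \<and>
               (\<forall>s\<in>{1..r}. \<exists>u\<in>C. \<exists>v\<in>C'. {u, v} \<in> snd G s)}"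

text \<open>
  The connected components of the cluster graph are the classes of the equivalence relation
  given by the reflexive transitive closure of its (symmetric) adjacency relation.
\<close>

definition merge_clusters :: "nat \<Rightarrow> 'v fold_graph \<Rightarrow> 'v set set \<Rightarrow> 'v set set" where
  "merge_clusters r G \<C> = \<Union> ` (\<C> // (cluster_graph r G \<C>)\<^sup>*)"

primrec clusters :: "nat \<Rightarrow> 'v fold_graph \<Rightarrow> nat \<Rightarrow> 'v set set" where
  "clusters r G 0 = (\<lambda>v. {v}) ` fst G"
| "clusters r G (Suc t) = merge_clusters r G (clusters r G t)"

text \<open>
  The sequence \<open>clusters r G t\<close> is continued after the algorithm stops, but it is constant from
  then on (see \<open>merge_clusters_stop\<close> and \<open>cluster_graph_single\<close> below). Hence the algorithm
  ends with a single cluster iff a single cluster occurs at some time.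
\<close>

definition percolates :: "nat \<Rightarrow> 'v fold_graph \<Rightarrow> bool" where
  "percolates r G \<longleftrightarrow> (\<exists>t. card (clusters r G t) = 1)"

lemma merge_clusters_stop:
  assumes "cluster_graph r G \<C> = {}"
  shows "merge_clusters r G \<C> = \<C>"
  using assms by (auto simp: merge_clusters_def quotient_def)

lemma cluster_graph_single:
  assumes "card \<C> = 1"
  shows "cluster_graph r G \<C> = {}"
  using assms by (auto simp: cluster_graph_def card_1_singleton_iff)

lemma sym_cluster_graph: "sym (cluster_graph r G \<C>)"
proof (rule symI)
  fix C C' assume "(C, C') \<in> cluster_graph r G \<C>"
  then have C: "C \<in> \<C>" "C' \<in> \<C>" "C \<noteq> C'"
    and *: "\<And>s. s \<in> {1..r} \<Longrightarrow> \<exists>u\<in>C. \<exists>v\<in>C'. {u, v} \<in> snd G s"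
    unfolding cluster_graph_def by blast+
  have "\<exists>u\<in>C'. \<exists>v\<in>C. {u, v} \<in> snd G s" if s: "s \<in> {1..r}" for s
  proof -
    obtain u v where "u \<in> C" "v \<in> C'" "{u, v} \<in> snd G s" using *[OF s] by blast
    then show ?thesis by (metis insert_commute)
  qed
  with C show "(C', C) \<in> cluster_graph r G \<C>"
    unfolding cluster_graph_def by blast
qed


subsection \<open>Binomial random graphs\<close>

definition gnp :: "nat \<Rightarrow> real \<Rightarrow> nat set set pmf" where
  "gnp n p = map_pmf (\<lambda>f. {e \<in> vertex_pairs {1..n}. f e})
     (Pi_pmf (vertex_pairs {1..n}) False (\<lambda>_. bernoulli_pmf p))"

definition fold_gnp :: "nat \<Rightarrow> nat \<Rightarrow> (nat \<Rightarrow> real) \<Rightarrow> nat fold_graph pmf" where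
  "fold_gnp r n p = map_pmf (\<lambda>E. ({1..n}, E)) (Pi_pmf {1..r} {} (\<lambda>i. gnp n (p i)))"

lemma is_fold_graph_fold_gnp:
  assumes "G \<in> set_pmf (fold_gnp r n p)"
  shows "is_fold_graph r G" and "fst G = {1..n}"
proof -
  obtain E where G: "G = ({1..n}, E)"
    and E: "E \<in> PiE_dflt {1..r} {} (\<lambda>i. set_pmf (gnp n (p i)))"
    using assms by (auto simp: fold_gnp_def set_Pi_pmf comp_def)
  have "A \<subseteq> vertex_pairs {1..n}" if "A \<in> set_pmf (gnp n q)" for A q
    using that unfolding gnp_def set_map_pmf by blast
  with E have "\<forall>i\<in>{1..r}. E i \<subseteq> vertex_pairs {1..n}" "\<forall>i. i \<notin> {1..r} \<longrightarrow> E i = {}"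
    unfolding PiE_dflt_def by blast+
  then show "is_fold_graph r G" and "fst G = {1..n}"
    by (simp_all add: G is_fold_graph_def)
qed

end

theory Submission
  imports Defs "HOL-Real_Asymp.Real_Asymp"
begin

text \<open>
  Non-percolation. Merging clusters one at a time, a percolating graph contains a vertex set of size
  roughly between \<open>ln n\<close> and \<open>2 ln n\<close> that is connected in every colour. A set of size \<open>k\<close> is
  connected in colour \<open>s\<close> with probability at most \<open>(k p\<^sub>s) ^ (k - 1)\<close>, by a union bound over spanning
  trees, and a union bound over all such sets suffices. If \<open>p\<^sub>1\<close> is too small, then colour 1
  has isolated vertices.

  Percolation. Write \<open>L = ln n\<close>. With high probability no set of at least \<open>L\<^sup>2\<close> vertices is stuck,
  i.e. proper and without an outside vertex joined to it in every colour; this is a plain union bound.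
  Hence it suffices to find a chain of \<open>L\<^sup>2\<close> vertices, each of them joined in every colour to the set of
  its predecessors. The vertices of a chain are taken from disjoint blocks, so that every step uses
  fresh edges. A single trial succeeds with probability at least \<open>n powr (- 1 / 4)\<close>. After a failed trial
  only the vertices of its chain are spoiled: edges between the remaining vertices have not been
  inspected. So there is room for \<open>sqrt n\<close> trials, each as likely to succeed as the first one.
\<close>

section \<open>Deterministic properties of the jigsaw process\<close>

text \<open>The obstacle is that a failed trial biases the edges it has inspected. A step from
  \<open>X\<close> inspects only edges between \<open>X\<close> and one block, and each of these has
  an end in \<open>X\<close>, which no later trial uses. So a failure costs one vertex per block but
  no independence. The products P_i enter by truncation: a vertex is joined to k given ones with
  probability at least 2^(-r) times the product of min 1 (k p_s), and since p_s increases with s,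
  this product is k^i P_i for some i. The hypotheses bound it below by C L / n times (k / L)^i for i
  \<ge> 2, and times k for i = 1. Hence the worst exponent is r for k \<le> L and 2 for L \<le> k
  \<le> L^2; from L^2 on the linear bound is the worst, because there (k / L)^2 catches up with k.
  This is where the chain length L^2 comes from. The logarithms of the step probabilities may lose
  only L / 4 in total. Equal blocks of size n / L^2 could leave each of the first L steps a chance
  of order 1 / L, which is far too little; so early blocks need size of order n / L, and later ones
  must shrink.\<close>

definition connected_on :: "'v set set \<Rightarrow> 'v set \<Rightarrow> bool" where
  "connected_on E S \<longleftrightarrow>
     (\<forall>A. A \<subseteq> S \<and> A \<noteq> {} \<and> A \<noteq> S \<longrightarrow> (\<exists>u\<in>A. \<exists>v\<in>S - A. {u, v} \<in> E))"

lemma connected_onD: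
  assumes "connected_on E S" "A \<subseteq> S" "A \<noteq> {}" "A \<noteq> S"
  obtains u v where "u \<in> A" "v \<in> S" "v \<notin> A" "{u, v} \<in> E"
  using assms unfolding connected_on_def by blast

lemma connected_on_singleton: "connected_on E {v}"
  by (auto simp: connected_on_def)

text \<open>A cut of the union splits one of the two sets or separates them, and in the latter case
  the edge between \<open>u\<close> and \<open>v\<close> crosses it. Connectedness is phrased by
  cuts instead of paths so that gluing and tree growing reduce to such case distinctions.\<close>

lemma connected_on_Un:
  assumes S: "connected_on E S" and T: "connected_on E T"
    and uv: "u \<in> S" "v \<in> T" "{u, v} \<in> E"
  shows "connected_on E (S \<union> T)"
  unfolding connected_on_def
proof (intro allI impI, elim conjE)
  fix A assume A: "A \<subseteq> S \<union> T" "A \<noteq> {}" "A \<noteq> S \<union> T"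
  consider "A \<inter> S \<noteq> {}" "A \<inter> S \<noteq> S" | "A \<inter> T \<noteq> {}" "A \<inter> T \<noteq> T"
    | "S \<subseteq> A" "A \<inter> T = {}" | "T \<subseteq> A" "A \<inter> S = {}"
    using A by blast
  then show "\<exists>u\<in>A. \<exists>v\<in>S \<union> T - A. {u, v} \<in> E"
  proof cases
    case 1
    then show ?thesis using S connected_onD[of E S "A \<inter> S"] by blast
  next
    case 2
    then show ?thesis using T connected_onD[of E T "A \<inter> T"] by blast
  next
    case 3
    then show ?thesis using uv by blast
  next
    case 4
    then have "v \<in> A" "u \<in> S \<union> T - A" "{v, u} \<in> E" using uv by (auto simp: insert_commute)
    then show ?thesis by blast
  qed
qed

text \<open>A round of the algorithm merges a whole component at once, so sizes can jump; this
  induction adds its clusters one by one. A maximal part of the component that contains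
  \<open>X\<close> and satisfies \<open>Q\<close> is everything, since otherwise some pair of
  \<open>R\<close> leaves it.\<close>

lemma component_induct:
  assumes fin: "finite \<C>" and R: "R \<subseteq> \<C> \<times> \<C>" and X: "X \<in> \<C>" and base: "Q {X}"
    and step: "\<And>U Y Z. U \<subseteq> \<C> \<Longrightarrow> Q U \<Longrightarrow> Y \<in> U \<Longrightarrow> (Y, Z) \<in> R \<Longrightarrow> Z \<notin> U \<Longrightarrow> Q (insert Z U)"
  shows "Q (R\<^sup>* `` {X})"
proof -
  have sub: "R\<^sup>* `` {X} \<subseteq> \<C>"
  proof
    fix Y assume "Y \<in> R\<^sup>* `` {X}"
    then have "(X, Y) \<in> R\<^sup>*" by simp
    then show "Y \<in> \<C>" by (induction rule: rtrancl_induct) (use X R in auto)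
  qed
  define F where "F = {U. U \<subseteq> R\<^sup>* `` {X} \<and> X \<in> U \<and> Q U}"
  have "finite F"
    by (rule finite_subset[of _ "Pow \<C>"]) (use sub fin in \<open>auto simp: F_def\<close>)
  moreover have "{X} \<in> F" using base by (auto simp: F_def)
  ultimately obtain U where U: "U \<in> F" and max: "\<And>W. W \<in> F \<Longrightarrow> U \<subseteq> W \<Longrightarrow> U = W"
    using finite_has_maximal[of F] by blast
  have "R\<^sup>* `` {X} \<subseteq> U"
  proof (rule ccontr)
    assume "\<not> R\<^sup>* `` {X} \<subseteq> U"
    then obtain W where W: "(X, W) \<in> R\<^sup>*" "W \<notin> U" by blast
    have "\<exists>Y Z. Y \<in> U \<and> (Y, Z) \<in> R \<and> Z \<notin> U"
    proof (rule ccontr)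
      assume *: "\<not> ?thesis"
      from W(1) have "W \<in> U"
        by (induction rule: rtrancl_induct) (use U * in \<open>auto simp: F_def\<close>)
      with W show False by simp
    qed
    then obtain Y Z where YZ: "Y \<in> U" "(Y, Z) \<in> R" "Z \<notin> U" by blast
    have UF: "U \<subseteq> R\<^sup>* `` {X}" "X \<in> U" "Q U" using U by (auto simp: F_def)
    then have "(X, Z) \<in> R\<^sup>*" using YZ by (meson Image_singleton_iff rtrancl.rtrancl_into_rtrancl subsetD)
    moreover have "Q (insert Z U)" using step UF sub YZ by (meson subset_trans)
    ultimately have "insert Z U \<in> F" using UF by (auto simp: F_def)
    with max YZ show False by blast
  qed
  with U have "U = R\<^sup>* `` {X}" by (auto simp: F_def)
  with U show ?thesis by (auto simp: F_def)
qed

section \<open>The partition process and its termination\<close>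

lemma cluster_graph_subset: "cluster_graph r G \<C> \<subseteq> \<C> \<times> \<C>"
  by (auto simp: cluster_graph_def)

lemma merge_clusters_eq:
  "merge_clusters r G \<C> = (\<lambda>X. \<Union> ((cluster_graph r G \<C>)\<^sup>* `` {X})) ` \<C>"
  by (auto simp: merge_clusters_def quotient_def)

lemma rtrancl_cluster_graph_closed:
  assumes "(X, Y) \<in> (cluster_graph r G \<C>)\<^sup>*" "X \<in> \<C>"
  shows "Y \<in> \<C>"
  using assms by (induction rule: rtrancl_induct) (auto simp: cluster_graph_def)

lemma partition_on_merge_clusters:
  assumes P: "partition_on V \<C>"
  shows "partition_on V (merge_clusters r G \<C>)"
proof -
  let ?R = "(cluster_graph r G \<C>)\<^sup>*"
  have symR: "sym ?R" by (rule sym_rtrancl[OF sym_cluster_graph])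
  have closed: "?R `` {X} \<subseteq> \<C>" if "X \<in> \<C>" for X
    using rtrancl_cluster_graph_closed[OF _ that] by blast
  have eq: "\<Union> (?R `` {X}) = \<Union> (?R `` {Y})"
    if XY: "X \<in> \<C>" "Y \<in> \<C>" "u \<in> \<Union> (?R `` {X})" "u \<in> \<Union> (?R `` {Y})" for X Y u
  proof -
    obtain X' Y' where *: "(X, X') \<in> ?R" "(Y, Y') \<in> ?R" "u \<in> X'" "u \<in> Y'" using XY by blast
    then have "X' \<in> \<C>" "Y' \<in> \<C>" using closed[OF XY(1)] closed[OF XY(2)] by blast+
    then have "X' = Y'" using P * unfolding partition_on_def disjoint_def by blast
    then have "(X, Y) \<in> ?R" using * symR by (meson rtrancl_trans symD)
    then have "?R `` {X} = ?R `` {Y}"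
      using symR by (auto intro: rtrancl_trans dest: symD)
    then show ?thesis by simp
  qed
  show ?thesis
  proof (rule partition_onI)
    show "\<Union> (merge_clusters r G \<C>) = V"
    proof
      show "\<Union> (merge_clusters r G \<C>) \<subseteq> V"
        using closed partition_onD1[OF P] unfolding merge_clusters_eq by blast
      show "V \<subseteq> \<Union> (merge_clusters r G \<C>)"
        using partition_onD1[OF P] unfolding merge_clusters_eq by blast
    qed
    show "{} \<notin> merge_clusters r G \<C>"
    proof
      assume "{} \<in> merge_clusters r G \<C>"
      then obtain X where X: "X \<in> \<C>" "\<Union> (?R `` {X}) = {}" unfolding merge_clusters_eq by auto
      then have "X = {}" by blast
      with X P show False by (auto simp: partition_on_def)
    qed
  next
    fix p q assume "p \<in> merge_clusters r G \<C>" "q \<in> merge_clusters r G \<C>" "p \<noteq> q"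
    then obtain X Y where "X \<in> \<C>" "p = \<Union> (?R `` {X})" "Y \<in> \<C>" "q = \<Union> (?R `` {Y})"
      unfolding merge_clusters_eq by auto
    with eq \<open>p \<noteq> q\<close> show "disjnt p q" unfolding disjnt_def by blast
  qed
qed

lemma partition_on_clusters: "partition_on (fst G) (clusters r G t)"
  by (induction t) (auto intro: partition_on_merge_clusters partition_on_singletons)

lemma finite_clusters: "finite (fst G) \<Longrightarrow> finite (clusters r G t)"
  by (induction t) (auto simp: merge_clusters_eq)

text \<open>Sending a cluster to the union of its component identifies two adjacent clusters, so
  this map is not injective.\<close>

lemma card_merge_clusters_less:
  assumes fin: "finite \<C>" and ne: "cluster_graph r G \<C> \<noteq> {}"
  shows "card (merge_clusters r G \<C>) < card \<C>"
proof -
  let ?R = "cluster_graph r G \<C>"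
  let ?f = "\<lambda>X. \<Union> (?R\<^sup>* `` {X})"
  from ne obtain X Y where XY: "(X, Y) \<in> ?R" by auto
  then have "(Y, X) \<in> ?R" using sym_cluster_graph by (metis symD)
  with XY have "?R\<^sup>* `` {X} = ?R\<^sup>* `` {Y}"
    by (auto intro: converse_rtrancl_into_rtrancl)
  then have "?f X = ?f Y" by simp
  moreover have "X \<in> \<C>" "Y \<in> \<C>" "X \<noteq> Y" using XY by (auto simp: cluster_graph_def)
  ultimately have "\<not> inj_on ?f \<C>" by (meson inj_onD)
  then show ?thesis
    using card_image_le[OF fin, of ?f] eq_card_imp_inj_on[OF fin, of ?f]
    unfolding merge_clusters_eq by linarith
qed

lemma clusters_stop:
  assumes "finite (fst G)"
  shows "\<exists>t. cluster_graph r G (clusters r G t) = {}"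
proof (rule ccontr)
  assume "\<nexists>t. cluster_graph r G (clusters r G t) = {}"
  then have *: "card (clusters r G (Suc t)) < card (clusters r G t)" for t
    using card_merge_clusters_less[OF finite_clusters[OF assms]] by simp
  have "card (clusters r G t) + t \<le> card (clusters r G 0)" for t
  proof (induction t)
    case (Suc t)
    with *[of t] show ?case by linarith
  qed simp
  from this[of "Suc (card (clusters r G 0))"] show False by simp
qed

text \<open>Adding the clusters of a component one at a time, the size less than doubles in each step.\<close>

lemma percolates_imp_medium_connected:
  assumes fin: "finite (fst G)" and perc: "percolates r G" and k: "1 < k" "k \<le> card (fst G)"
  shows "\<exists>S\<subseteq>fst G. k \<le> card S \<and> card S \<le> 2 * k \<and> (\<forall>s\<in>{1..r}. connected_on (snd G s) S)"
proof (rule ccontr)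
  define good where "good S \<longleftrightarrow> (\<forall>s\<in>{1..r}. connected_on (snd G s) S)" for S
  assume "\<not> ?thesis"
  \<comment> \<open>The failed conclusion leaves a gap: no set that is connected in every colour has
    size between \<open>k\<close> and \<open>2 * k\<close>. A union of two such sets of size below
    \<open>k\<close> cannot jump over the gap, so all clusters stay below it forever, contradicting
    the final cluster.\<close>
  then have no: "card S < k" if "S \<subseteq> fst G" "good S" "card S \<le> 2 * k" for S
    using that unfolding good_def by (meson not_le)
  have "good X \<and> card X < k" if "X \<in> clusters r G t" for X t
    using that
  proof (induction t arbitrary: X)
    case 0
    then show ?case using k by (auto simp: good_def connected_on_singleton)
  next
    case (Suc t)
    let ?C = "clusters r G t"
    let ?R = "cluster_graph r G ?C"
    obtain X0 where X0: "X0 \<in> ?C" "X = \<Union> (?R\<^sup>* `` {X0})" using Suc.prems by (auto simp: merge_clusters_eq)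
    have VC: "fst G = \<Union> ?C" using partition_onD1[OF partition_on_clusters] .
    have "good (\<Union> (?R\<^sup>* `` {X0})) \<and> card (\<Union> (?R\<^sup>* `` {X0})) < k"
    proof (rule component_induct[where Q = "\<lambda>U. good (\<Union> U) \<and> card (\<Union> U) < k"])
      show "good (\<Union> {X0}) \<and> card (\<Union> {X0}) < k" using Suc.IH X0 by simp
    next
      fix U Y Z assume U: "U \<subseteq> ?C" "good (\<Union> U) \<and> card (\<Union> U) < k" "Y \<in> U" "(Y, Z) \<in> ?R" "Z \<notin> U"
      have Z: "Z \<in> ?C" using U(4) by (auto simp: cluster_graph_def)
      have "good (\<Union> U \<union> Z)"
        unfolding good_def
      proof
        fix s assume s: "s \<in> {1..r}"
        then obtain u v where "u \<in> Y" "v \<in> Z" "{u, v} \<in> snd G s"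
          using U(4) unfolding cluster_graph_def by blast
        then show "connected_on (snd G s) (\<Union> U \<union> Z)"
          using U Suc.IH[OF Z] s by (intro connected_on_Un[of _ _ _ u v]) (auto simp: good_def)
      qed
      moreover have "card (\<Union> U \<union> Z) \<le> 2 * k"
        using card_Un_le[of "\<Union> U" Z] U Suc.IH[OF Z] by linarith
      moreover have "\<Union> U \<union> Z \<subseteq> fst G" using U Z VC by blast
      ultimately show "good (\<Union> (insert Z U)) \<and> card (\<Union> (insert Z U)) < k"
        using no[of "\<Union> U \<union> Z"] by (simp add: Un_commute)
    qed (use X0 in \<open>simp_all add: finite_clusters[OF fin] cluster_graph_subset\<close>)
    with X0 show ?case by simp
  qed note small = this
  from perc obtain t X where "clusters r G t = {X}"
    by (auto simp: percolates_def card_1_singleton_iff)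
  with small[of X t] partition_onD1[OF partition_on_clusters, of G r t] k show False by simp
qed

section \<open>Chains and stuck sets\<close>

definition joined :: "nat \<Rightarrow> (nat \<Rightarrow> 'v set set) \<Rightarrow> 'v set \<Rightarrow> 'v \<Rightarrow> bool" where
  "joined r E X v \<longleftrightarrow> (\<forall>s\<in>{1..r}. \<exists>x\<in>X. {x, v} \<in> E s)"

text \<open>A sequential version of the process that absorbs single vertices and ignores the rounds
  of the algorithm; different colours may use different neighbours in \<open>X\<close>.\<close>

inductive jigsaw_chain :: "nat \<Rightarrow> (nat \<Rightarrow> 'v set set) \<Rightarrow> 'v set \<Rightarrow> bool" for r E where
  start: "jigsaw_chain r E {v}"
| extend: "jigsaw_chain r E X \<Longrightarrow> joined r E X v \<Longrightarrow> jigsaw_chain r E (insert v X)"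

text \<open>Being joined to \<open>X\<close> passes to every superset of \<open>X\<close>. So in a
  final partition the cluster of the next vertex would be adjacent to the cluster containing
  \<open>X\<close>, unless the two coincide.\<close>

lemma jigsaw_chain_in_cluster:
  assumes "jigsaw_chain r (snd G) X" "X \<subseteq> \<Union> \<C>" and "cluster_graph r G \<C> = {}"
  shows "\<exists>C\<in>\<C>. X \<subseteq> C"
  using assms(1,2)
proof (induction rule: jigsaw_chain.induct)
  case (extend X v)
  then obtain C C' where C: "C \<in> \<C>" "X \<subseteq> C" "C' \<in> \<C>" "v \<in> C'" by auto
  have "C = C'"
  proof (rule ccontr)
    assume "C \<noteq> C'"
    with C extend.hyps have "(C, C') \<in> cluster_graph r G \<C>"
      by (fastforce simp: cluster_graph_def joined_def)
    with assms show False by simp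
  qed
  with C show ?case by auto
qed auto

text \<open>In the final partition the cluster \<open>C\<close> that contains the chain is large. If
  it were not the whole vertex set, a vertex joined to it would lie in a cluster adjacent to
  \<open>C\<close>.\<close>

lemma percolates_if_no_stuck_set:
  assumes fin: "finite (fst G)"
    and chain: "jigsaw_chain r (snd G) X" "X \<subseteq> fst G" and k: "k \<le> card X"
    and grow: "\<And>S. S \<subseteq> fst G \<Longrightarrow> k \<le> card S \<Longrightarrow> S \<noteq> fst G \<Longrightarrow> \<exists>v\<in>fst G - S. joined r (snd G) S v"
  shows "percolates r G"
proof -
  obtain t where t: "cluster_graph r G (clusters r G t) = {}" using clusters_stop[OF fin] by blast
  let ?C = "clusters r G t"
  have P: "partition_on (fst G) ?C" by (rule partition_on_clusters)
  have U: "fst G = \<Union> ?C" using partition_onD1[OF P] .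
  obtain C where C: "C \<in> ?C" "X \<subseteq> C" using jigsaw_chain_in_cluster[OF chain(1) _ t] chain U by auto
  have "C = fst G"
  proof (rule ccontr)
    assume ne: "C \<noteq> fst G"
    have "C \<subseteq> fst G" using C U by blast
    moreover have "k \<le> card C"
      using k card_mono[OF finite_subset[OF \<open>C \<subseteq> fst G\<close> fin] C(2)] by linarith
    ultimately obtain v where v: "v \<in> fst G - C" "joined r (snd G) C v" using grow ne by blast
    then obtain C' where C': "C' \<in> ?C" "v \<in> C'" using U by blast
    with v C have "(C, C') \<in> cluster_graph r G ?C" by (fastforce simp: cluster_graph_def joined_def)
    with t show False by simp
  qed
  have "?C = {C}"
  proof -
    have "C' = C" if "C' \<in> ?C" for C'
    proof -
      have "C' \<noteq> {}" "C' \<subseteq> C" using that P U \<open>C = fst G\<close> by (auto simp: partition_on_def)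
      then show ?thesis using that C P unfolding partition_on_def disjoint_def by blast
    qed
    with C show ?thesis by blast
  qed
  then show ?thesis by (auto simp: percolates_def intro!: exI[of _ t])
qed

section \<open>Independence in product spaces\<close>

text \<open>\<open>J\<close> ranges over coordinates of the whole index type, not just those of a
  given finite product. This allows index sets such as \<open>UNIV \<times> F\<close> and
  complements \<open>- J\<close>.\<close>

definition depends_on :: "'a set \<Rightarrow> ('a \<Rightarrow> 'b) set \<Rightarrow> bool" where
  "depends_on J A \<longleftrightarrow> (\<forall>f g. (\<forall>x\<in>J. f x = g x) \<longrightarrow> f \<in> A \<longrightarrow> g \<in> A)"

lemma depends_onI:
  assumes "\<And>f g. (\<And>x. x \<in> J \<Longrightarrow> f x = g x) \<Longrightarrow> f \<in> A \<Longrightarrow> g \<in> A"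
  shows "depends_on J A"
  using assms unfolding depends_on_def by blast

lemma depends_on_iff:
  assumes "depends_on J A" "\<And>x. x \<in> J \<Longrightarrow> f x = g x"
  shows "f \<in> A \<longleftrightarrow> g \<in> A"
  using assms unfolding depends_on_def by metis

lemma depends_on_mono: "depends_on J A \<Longrightarrow> J \<subseteq> K \<Longrightarrow> depends_on K A"
  unfolding depends_on_def by (meson subsetD)

lemma depends_on_Inter:
  assumes "\<And>t. t \<in> T \<Longrightarrow> depends_on (J t) (A t)"
  shows "depends_on (\<Union>t\<in>T. J t) (\<Inter>t\<in>T. A t)"
  using assms unfolding depends_on_def by (metis INT_iff UN_iff)

text \<open>The product splits into independent factors over \<open>I \<inter> J\<close> and
  \<open>I - J\<close>; \<open>A\<close> can be read off from the first and \<open>B\<close> from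
  the second.\<close>

lemma prob_Pi_pmf_Int:
  assumes I: "finite I" and A: "depends_on J A" and B: "depends_on (- J) B"
  shows "measure_pmf.prob (Pi_pmf I d p) (A \<inter> B) =
    measure_pmf.prob (Pi_pmf I d p) A * measure_pmf.prob (Pi_pmf I d p) B"
proof -
  define M where "M = Pi_pmf (I \<inter> J) d p"
  define N where "N = Pi_pmf (I - J) d p"
  define h where "h = (\<lambda>(f, g) x. if x \<in> I \<inter> J then f x else (g x :: 'b))"
  have "I = (I \<inter> J) \<union> (I - J)" by blast
  then have split: "Pi_pmf I d p = map_pmf h (pair_pmf M N)"
    using Pi_pmf_union[of "I \<inter> J" "I - J" d p] I by (auto simp: M_def N_def h_def)
  \<comment> \<open>Off its index set each factor takes the value \<open>d\<close>. So
    \<open>h (f, g)\<close> agrees with \<open>f\<close> on all of \<open>J\<close>, and with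
    \<open>g\<close> on all of \<open>- J\<close>, also at coordinates outside
    \<open>I\<close>.\<close>
  have out: "f x = d" if "f \<in> set_pmf M" "x \<notin> I \<inter> J" for f x
    using that set_Pi_pmf_subset[of "I \<inter> J" d p] I by (auto simp: M_def)
  have out': "f x = d" if "f \<in> set_pmf N" "x \<notin> I - J" for f x
    using that set_Pi_pmf_subset[of "I - J" d p] I by (auto simp: N_def)
  have hA: "h (f, g) \<in> A \<longleftrightarrow> f \<in> A" if "f \<in> set_pmf M" "g \<in> set_pmf N" for f g
    using that out out' by (intro depends_on_iff[OF A]) (auto simp: h_def)
  have hB: "h (f, g) \<in> B \<longleftrightarrow> g \<in> B" if "f \<in> set_pmf M" "g \<in> set_pmf N" for f g
    using that out out' by (intro depends_on_iff[OF B]) (auto simp: h_def)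
  have *: "measure_pmf.prob (Pi_pmf I d p) S = measure_pmf.prob M S1 * measure_pmf.prob N S2"
    if "\<And>f g. f \<in> set_pmf M \<Longrightarrow> g \<in> set_pmf N \<Longrightarrow> h (f, g) \<in> S \<longleftrightarrow> f \<in> S1 \<and> g \<in> S2" for S S1 S2
  proof -
    have "measure_pmf.prob (Pi_pmf I d p) S = measure_pmf.prob (pair_pmf M N) (h -` S)"
      unfolding split by (simp add: vimage_def)
    also have "\<dots> = measure_pmf.prob (pair_pmf M N) ((S1 \<inter> set_pmf M) \<times> (S2 \<inter> set_pmf N))"
      using that by (intro measure_prob_cong_0) (auto simp: pmf_pair pmf_eq_0_set_pmf)
    also have "\<dots> = measure_pmf.prob M (S1 \<inter> set_pmf M) * measure_pmf.prob N (S2 \<inter> set_pmf N)"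
      by (rule measure_pmf_prob_product) auto
    finally show ?thesis by (simp add: measure_Int_set_pmf)
  qed
  have "measure_pmf.prob (Pi_pmf I d p) (A \<inter> B) = measure_pmf.prob M A * measure_pmf.prob N B"
    using hA hB by (intro *) auto
  moreover have "measure_pmf.prob (Pi_pmf I d p) A = measure_pmf.prob M A * measure_pmf.prob N UNIV"
    using hA by (intro *) auto
  moreover have "measure_pmf.prob (Pi_pmf I d p) B = measure_pmf.prob M UNIV * measure_pmf.prob N B"
    using hB by (intro *) auto
  ultimately show ?thesis by simp
qed

lemma prob_Pi_pmf_INT:
  assumes I: "finite I" and T: "finite T"
    and dep: "\<And>t. t \<in> T \<Longrightarrow> depends_on (J t) (A t)"
    and disj: "\<And>t u. t \<in> T \<Longrightarrow> u \<in> T \<Longrightarrow> t \<noteq> u \<Longrightarrow> J t \<inter> J u = {}"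
  shows "measure_pmf.prob (Pi_pmf I d p) (\<Inter>t\<in>T. A t) = (\<Prod>t\<in>T. measure_pmf.prob (Pi_pmf I d p) (A t))"
  using T dep disj
proof (induction T rule: finite_induct)
  case (insert t T)
  have "depends_on (- J t) (\<Inter>u\<in>T. A u)"
  proof (rule depends_on_mono[OF depends_on_Inter[of T J A]])
    have "J u \<inter> J t = {}" if "u \<in> T" for u
      using insert.prems(2)[of u t] insert.hyps that by auto
    then show "(\<Union>u\<in>T. J u) \<subseteq> - J t" by blast
  qed (use insert.prems in auto)
  moreover have "depends_on (J t) (A t)" using insert by simp
  ultimately have "measure_pmf.prob (Pi_pmf I d p) (A t \<inter> (\<Inter>u\<in>T. A u)) =
    measure_pmf.prob (Pi_pmf I d p) (A t) * measure_pmf.prob (Pi_pmf I d p) (\<Inter>u\<in>T. A u)"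
    by (intro prob_Pi_pmf_Int[OF I, of "J t"])
  with insert show ?case by simp
qed simp

text \<open>Currying for products of pmfs. It flattens the independent colours, each a product over
  edges, into one product over coloured edges. Both sides have the same mass at every point.\<close>

lemma Pi_pmf_Sigma:
  assumes "finite A" "finite B"
  shows "Pi_pmf (A \<times> B) d (\<lambda>(a, b). p a b) =
    map_pmf (\<lambda>f (a, b). f a b) (Pi_pmf A (\<lambda>_. d) (\<lambda>a. Pi_pmf B d (p a)))"
proof (rule pmf_eqI)
  fix g :: "'a \<times> 'b \<Rightarrow> 'c"
  define f where "f = (\<lambda>a b. g (a, b))"
  let ?u = "\<lambda>f (a :: 'a, b :: 'b). f a b :: 'c"
  have inj: "inj ?u"
    by (rule injI) (auto simp: fun_eq_iff)
  have g: "g = ?u f" by (auto simp: f_def)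
  have "pmf (map_pmf ?u (Pi_pmf A (\<lambda>_. d) (\<lambda>a. Pi_pmf B d (p a)))) g =
    pmf (Pi_pmf A (\<lambda>_. d) (\<lambda>a. Pi_pmf B d (p a))) f"
    unfolding g by (rule pmf_map_inj'[OF inj])
  also have "\<dots> = pmf (Pi_pmf (A \<times> B) d (\<lambda>(a, b). p a b)) g"
  proof (cases "\<forall>x. x \<notin> A \<times> B \<longrightarrow> g x = d")
    case True
    then have "\<forall>a. a \<notin> A \<longrightarrow> f a = (\<lambda>_. d)" "\<And>a. \<forall>b. b \<notin> B \<longrightarrow> f a b = d"
      by (auto simp: f_def)
    then have "pmf (Pi_pmf A (\<lambda>_. d) (\<lambda>a. Pi_pmf B d (p a))) f = (\<Prod>a\<in>A. \<Prod>b\<in>B. pmf (p a b) (f a b))"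
      using assms by (simp add: pmf_Pi)
    also have "\<dots> = (\<Prod>x\<in>A \<times> B. pmf ((\<lambda>(a, b). p a b) x) (g x))"
      by (simp add: prod.cartesian_product f_def case_prod_unfold)
    finally show ?thesis using True assms by (simp add: pmf_Pi)
  next
    case False
    then obtain a b where ab: "(a, b) \<notin> A \<times> B" "f a b \<noteq> d" by (auto simp: f_def)
    \<comment> \<open>A value other than the default at (a, b) outside the rectangle is excluded by
      the inner product if \<open>a \<in> A\<close>, and by the outer one, whose default is the
      constant function \<open>d\<close>, if not.\<close>
    have "pmf (Pi_pmf A (\<lambda>_. d) (\<lambda>a. Pi_pmf B d (p a))) f = 0"
    proof (cases "a \<in> A")
      case True
      then have "pmf (Pi_pmf B d (p a)) (f a) = 0" using ab assms by (auto simp: pmf_Pi)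
      then have "(\<Prod>a\<in>A. pmf (Pi_pmf B d (p a)) (f a)) = 0" using True assms by auto
      then show ?thesis using assms by (simp add: pmf_Pi[OF assms(1)])
    next
      case False
      then show ?thesis using ab assms by (auto simp: pmf_Pi fun_eq_iff)
    qed
    moreover have "pmf (Pi_pmf (A \<times> B) d (\<lambda>(a, b). p a b)) g = 0"
      using False assms by (subst pmf_Pi) auto
    ultimately show ?thesis by simp
  qed
  finally show "pmf (Pi_pmf (A \<times> B) d (\<lambda>(a, b). p a b)) g =
    pmf (map_pmf ?u (Pi_pmf A (\<lambda>_. d) (\<lambda>a. Pi_pmf B d (p a)))) g" by simp
qed

section \<open>The product space of coloured edges\<close>

definition edge_pmf :: "nat \<Rightarrow> nat \<Rightarrow> (nat \<Rightarrow> real) \<Rightarrow> (nat \<times> nat set \<Rightarrow> bool) pmf" where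
  "edge_pmf r n p = Pi_pmf ({1..r} \<times> vertex_pairs {1..n}) False (\<lambda>(s, e). bernoulli_pmf (p s))"

abbreviation edge_prob :: "nat \<Rightarrow> nat \<Rightarrow> (nat \<Rightarrow> real) \<Rightarrow> (nat \<times> nat set \<Rightarrow> bool) set \<Rightarrow> real" where
  "edge_prob r n p \<equiv> measure_pmf.prob (edge_pmf r n p)"

definition edges :: "(nat \<times> nat set \<Rightarrow> bool) \<Rightarrow> nat \<Rightarrow> nat set set" where
  "edges \<omega> s = {e. \<omega> (s, e)}"

lemma finite_vertex_pairs [simp]: "finite V \<Longrightarrow> finite (vertex_pairs V)"
  by (rule finite_subset[of _ "Pow V"]) (auto simp: vertex_pairs_def)

lemma set_edge_pmf:
  assumes "\<omega> \<in> set_pmf (edge_pmf r n p)" "\<omega> (s, e)"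
  shows "s \<in> {1..r}" "e \<in> vertex_pairs {1..n}"
proof -
  have "(s, e) \<in> {1..r} \<times> vertex_pairs {1..n}"
    using assms set_Pi_pmf_subset[of "{1..r} \<times> vertex_pairs {1..n}" False "\<lambda>(s, e). bernoulli_pmf (p s)"]
    unfolding edge_pmf_def by auto
  then show "s \<in> {1..r}" "e \<in> vertex_pairs {1..n}" by auto
qed

lemma fold_gnp_eq: "fold_gnp r n p = map_pmf (\<lambda>\<omega>. ({1..n}, edges \<omega>)) (edge_pmf r n p)"
proof -
  let ?V = "vertex_pairs {1..n}"
  let ?g = "\<lambda>f. {e \<in> ?V. f e}"
  let ?Q = "\<lambda>i. Pi_pmf ?V False (\<lambda>_. bernoulli_pmf (p i))"
  have "fold_gnp r n p = map_pmf (\<lambda>E. ({1..n}, E)) (map_pmf (\<lambda>h. ?g \<circ> h) (Pi_pmf {1..r} (\<lambda>_. False) ?Q))"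
    unfolding fold_gnp_def gnp_def by (subst Pi_pmf_map[where dflt = "\<lambda>_. False"]) auto
  \<comment> \<open>\<open>edges\<close> does not restrict to vertex pairs, so the two maps agree
    only on the support; that suffices for equal distributions.\<close>
  moreover have "map_pmf (\<lambda>\<omega>. ({1..n}, edges \<omega>)) (edge_pmf r n p) =
     map_pmf (\<lambda>\<omega>. ({1..n}, \<lambda>s. {e \<in> ?V. \<omega> (s, e)})) (edge_pmf r n p)"
    by (rule map_pmf_cong) (auto simp: edges_def fun_eq_iff simp del: One_nat_def dest: set_edge_pmf)
  moreover have "edge_pmf r n p = map_pmf (\<lambda>f (a, b). f a b) (Pi_pmf {1..r} (\<lambda>_. False) ?Q)"
    unfolding edge_pmf_def by (subst Pi_pmf_Sigma) auto
  ultimately show ?thesis by (simp add: map_pmf_comp o_def)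
qed

lemma prob_fold_gnp:
  "measure_pmf.prob (fold_gnp r n p) {G. Q G} = edge_prob r n p {\<omega>. Q ({1..n}, edges \<omega>)}"
  unfolding fold_gnp_eq by (simp add: vimage_def)

lemma edge_prob_Int:
  "depends_on J A \<Longrightarrow> depends_on (- J) B \<Longrightarrow> edge_prob r n p (A \<inter> B) = edge_prob r n p A * edge_prob r n p B"
  unfolding edge_pmf_def by (rule prob_Pi_pmf_Int) auto

lemma edge_prob_INT:
  assumes "finite T" "\<And>t. t \<in> T \<Longrightarrow> depends_on (J t) (A t)"
    and "\<And>t u. t \<in> T \<Longrightarrow> u \<in> T \<Longrightarrow> t \<noteq> u \<Longrightarrow> J t \<inter> J u = {}"
  shows "edge_prob r n p (\<Inter>t\<in>T. A t) = (\<Prod>t\<in>T. edge_prob r n p (A t))"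
  unfolding edge_pmf_def by (rule prob_Pi_pmf_INT) (use assms in auto)

lemma edge_prob_mono: "A \<subseteq> B \<Longrightarrow> edge_prob r n p A \<le> edge_prob r n p B"
  by (rule measure_pmf.finite_measure_mono) auto

lemma edge_prob_compl: "edge_prob r n p {\<omega>. \<not> Q \<omega>} = 1 - edge_prob r n p {\<omega>. Q \<omega>}"
  using measure_pmf.prob_compl[of "{\<omega>. Q \<omega>}" "edge_pmf r n p"] by (simp add: set_diff_eq)

lemma edge_prob_UN_le:
  "finite T \<Longrightarrow> edge_prob r n p (\<Union>t\<in>T. A t) \<le> (\<Sum>t\<in>T. edge_prob r n p (A t))"
  by (rule measure_pmf.finite_measure_subadditive_finite) auto

lemma edge_prob_edge:
  assumes "s \<in> {1..r}" "e \<in> vertex_pairs {1..n}" "p s \<in> {0..1}"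
  shows "edge_prob r n p {\<omega>. \<omega> (s, e)} = p s"
proof -
  have "edge_prob r n p {\<omega>. \<omega> (s, e)} = measure_pmf.prob (map_pmf (\<lambda>\<omega>. \<omega> (s, e)) (edge_pmf r n p)) {True}"
    by (simp add: vimage_def)
  also have "map_pmf (\<lambda>\<omega>. \<omega> (s, e)) (edge_pmf r n p) = bernoulli_pmf (p s)"
    using assms unfolding edge_pmf_def by (subst Pi_pmf_component) auto
  finally show ?thesis using assms by (simp add: measure_pmf_single)
qed

lemma edge_prob_all_edges:
  assumes "s \<in> {1..r}" "F \<subseteq> vertex_pairs {1..n}" "p s \<in> {0..1}"
  shows "edge_prob r n p {\<omega>. \<forall>e\<in>F. \<omega> (s, e)} = p s ^ card F"
proof -
  have "finite F" using assms(2) by (rule finite_subset) simp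
  then have "edge_prob r n p (\<Inter>e\<in>F. {\<omega>. \<omega> (s, e)}) = (\<Prod>e\<in>F. edge_prob r n p {\<omega>. \<omega> (s, e)})"
    by (intro edge_prob_INT[where J = "\<lambda>e. {(s, e)}"] depends_onI) auto
  moreover have "(\<Inter>e\<in>F. {\<omega>. \<omega> (s, e)}) = {\<omega>. \<forall>e\<in>F. \<omega> (s, e)}" by auto
  moreover have "edge_prob r n p {\<omega>. \<omega> (s, e)} = p s" if "e \<in> F" for e
    using assms that by (intro edge_prob_edge) auto
  ultimately show ?thesis by simp
qed

lemma edge_prob_no_edge:
  assumes "s \<in> {1..r}" "F \<subseteq> vertex_pairs {1..n}" "p s \<in> {0..1}"
  shows "edge_prob r n p {\<omega>. \<forall>e\<in>F. \<not> \<omega> (s, e)} = (1 - p s) ^ card F"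
proof -
  have "finite F" using assms(2) by (rule finite_subset) simp
  then have "edge_prob r n p (\<Inter>e\<in>F. {\<omega>. \<not> \<omega> (s, e)}) = (\<Prod>e\<in>F. edge_prob r n p {\<omega>. \<not> \<omega> (s, e)})"
    by (intro edge_prob_INT[where J = "\<lambda>e. {(s, e)}"] depends_onI) auto
  moreover have "(\<Inter>e\<in>F. {\<omega>. \<not> \<omega> (s, e)}) = {\<omega>. \<forall>e\<in>F. \<not> \<omega> (s, e)}" by auto
  moreover have "edge_prob r n p {\<omega>. \<not> \<omega> (s, e)} = 1 - p s" if "e \<in> F" for e
    using assms that edge_prob_edge[of s r e n p] by (simp add: edge_prob_compl subset_iff)
  ultimately show ?thesis by simp
qed

section \<open>Growing a chain through disjoint blocks\<close>

text \<open>The probability that a fixed vertex outside a set of \<open>k\<close> vertices is joined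
  to it, with one factor per colour.\<close>

definition join_prob :: "nat \<Rightarrow> (nat \<Rightarrow> real) \<Rightarrow> nat \<Rightarrow> real" where
  "join_prob r p k = (\<Prod>s=1..r. 1 - (1 - p s) ^ k)"

lemma depends_on_joined:
  "depends_on (UNIV \<times> (\<lambda>x. {x, v}) ` X) {\<omega>. joined r (edges \<omega>) X v}"
  by (rule depends_onI) (auto simp: joined_def edges_def)

text \<open>The number \<open>m\<close> of colours is kept separate from \<open>r\<close>, because
  the case \<open>m = 1\<close> treats vertices isolated in colour 1.\<close>

lemma edge_prob_joined:
  assumes p: "p \<in> {1..r} \<rightarrow> {0..1}" and m: "m \<le> r" and X: "X \<subseteq> {1..n}" "v \<in> {1..n}" "v \<notin> X"
  shows "edge_prob r n p {\<omega>. joined m (edges \<omega>) X v} = join_prob m p (card X)"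
proof -
  let ?F = "(\<lambda>x. {x, v}) ` X"
  let ?A = "\<lambda>s. {\<omega>. \<not> (\<forall>e\<in>?F. \<not> \<omega> (s, e))} :: (nat \<times> nat set \<Rightarrow> bool) set"
  have "{\<omega>. joined m (edges \<omega>) X v} = (\<Inter>s\<in>{1..m}. ?A s)"
    by (auto simp: joined_def edges_def)
  also have "edge_prob r n p \<dots> = (\<Prod>s=1..m. edge_prob r n p (?A s))"
    by (rule edge_prob_INT[where J = "\<lambda>s. {s} \<times> UNIV"]) (auto intro!: depends_onI)
  also have "\<dots> = join_prob m p (card X)"
    unfolding join_prob_def
  proof (rule prod.cong)
    fix s assume "s \<in> {1..m}"
    with m have s: "s \<in> {1..r}" by simp
    have "card ?F = card X"
      using X by (intro card_image inj_onI) (auto simp: doubleton_eq_iff)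
    moreover have "?F \<subseteq> vertex_pairs {1..n}"
    proof
      fix e assume "e \<in> ?F"
      then obtain x where "x \<in> X" "e = {x, v}" by auto
      moreover from this have "x \<noteq> v" using X by auto
      ultimately show "e \<in> vertex_pairs {1..n}"
        using X by (auto simp: vertex_pairs_def)
    qed
    ultimately show "edge_prob r n p (?A s) = 1 - (1 - p s) ^ card X"
      using edge_prob_no_edge[of s r ?F n p] funcset_mem[OF p s] s by (simp only: edge_prob_compl)
  qed simp
  finally show ?thesis .
qed

text \<open>Since \<open>X\<close> misses \<open>B\<close>, the stars from different vertices of
  \<open>B\<close> to \<open>X\<close> have no edge in common.\<close>

lemma edge_prob_none_joined:
  assumes p: "p \<in> {1..r} \<rightarrow> {0..1}"
    and XB: "X \<subseteq> {1..n}" "B \<subseteq> {1..n}" "X \<inter> B = {}"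
  shows "edge_prob r n p {\<omega>. \<forall>v\<in>B. \<not> joined r (edges \<omega>) X v} = (1 - join_prob r p (card X)) ^ card B"
proof -
  let ?A = "\<lambda>v. {\<omega>. \<not> joined r (edges \<omega>) X v}"
  have "{\<omega>. \<forall>v\<in>B. \<not> joined r (edges \<omega>) X v} = (\<Inter>v\<in>B. ?A v)" by auto
  also have "edge_prob r n p \<dots> = (\<Prod>v\<in>B. edge_prob r n p (?A v))"
  proof (rule edge_prob_INT[where J = "\<lambda>v. UNIV \<times> (\<lambda>x. {x, v}) ` X"])
    show "finite B" using XB(2) by (rule finite_subset) simp
    show "UNIV \<times> (\<lambda>x. {x, t}) ` X \<inter> UNIV \<times> (\<lambda>x. {x, u}) ` X = {}"
      if "t \<in> B" "u \<in> B" "t \<noteq> u" for t u :: nat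
      using that XB by (auto simp: doubleton_eq_iff)
  qed (auto intro!: depends_onI simp: joined_def edges_def)
  also have "\<dots> = (\<Prod>v\<in>B. 1 - join_prob r p (card X))"
  proof (rule prod.cong)
    fix v assume "v \<in> B"
    then show "edge_prob r n p (?A v) = 1 - join_prob r p (card X)"
      unfolding edge_prob_compl using XB by (subst edge_prob_joined[OF p order_refl]) auto
  qed simp
  finally show ?thesis by simp
qed

lemma join_prob_bounds:
  assumes "p \<in> {1..r} \<rightarrow> {0..1}"
  shows "0 \<le> join_prob r p k" "join_prob r p k \<le> 1"
proof -
  have "0 \<le> 1 - (1 - p s) ^ k \<and> 1 - (1 - p s) ^ k \<le> 1" if "s \<in> {1..r}" for s
    using funcset_mem[OF assms that] by (auto intro!: power_le_one)
  then show "0 \<le> join_prob r p k" "join_prob r p k \<le> 1"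
    unfolding join_prob_def by (auto intro!: prod_nonneg prod_le_1)
qed

text \<open>The index \<open>k\<close> of the block searched next is the current size of
  \<open>X\<close> in all uses. The quantifiers search over all continuations; a particular choice,
  the least candidate, is made only in the probability estimate.\<close>

primrec extends :: "nat \<Rightarrow> (nat \<Rightarrow> 'v set) \<Rightarrow> (nat \<Rightarrow> 'v set set) \<Rightarrow> nat \<Rightarrow> nat \<Rightarrow> 'v set \<Rightarrow> bool" where
  "extends r B E 0 k X = True"
| "extends r B E (Suc d) k X = (\<exists>v\<in>B k. joined r E X v \<and> extends r B E d (Suc k) (insert v X))"

text \<open>A chain consists of a start vertex from \<open>B 0\<close> and one vertex from each of
  \<open>B 1\<close>, ..., \<open>B d\<close>, that is \<open>d + 1\<close> vertices.\<close>

definition no_chain :: "nat \<Rightarrow> (nat \<Rightarrow> 'v set) \<Rightarrow> (nat \<Rightarrow> 'v set set) \<Rightarrow> nat \<Rightarrow> bool" where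
  "no_chain r B E d \<longleftrightarrow> (\<forall>v\<in>B 0. \<not> extends r B E d 1 {v})"

lemma extends_imp_jigsaw_chain:
  assumes "extends r B E d k X" "jigsaw_chain r E X" "finite X"
    and "\<And>i. k \<le> i \<Longrightarrow> X \<inter> B i = {}" "disjoint_family B" "X \<subseteq> V" "\<And>i. B i \<subseteq> V"
  shows "\<exists>Y\<subseteq>V. jigsaw_chain r E Y \<and> card Y = card X + d"
  using assms
proof (induction d arbitrary: k X)
  case (Suc d)
  then obtain v where v: "v \<in> B k" "joined r E X v" "extends r B E d (Suc k) (insert v X)" by auto
  have "v \<notin> X" using v Suc.prems(4)[of k] by auto
  have "\<exists>Y\<subseteq>V. jigsaw_chain r E Y \<and> card Y = card (insert v X) + d"
  proof (rule Suc.IH[OF v(3)])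
    show "jigsaw_chain r E (insert v X)" using Suc.prems v by (auto intro: jigsaw_chain.extend)
    fix i assume i: "Suc k \<le> i"
    then have "B k \<inter> B i = {}" using Suc.prems(5) by (auto simp: disjoint_family_on_def)
    then show "insert v X \<inter> B i = {}" using v Suc.prems(4)[of i] i by auto
  qed (use Suc.prems(3,5,6,7) v in auto)
  then show ?case using \<open>v \<notin> X\<close> Suc.prems by simp
qed auto

lemma not_no_chainD:
  assumes "\<not> no_chain r B E d" "disjoint_family B" "\<And>i. B i \<subseteq> V"
  shows "\<exists>Y\<subseteq>V. jigsaw_chain r E Y \<and> card Y = Suc d"
proof -
  obtain v where v: "v \<in> B 0" "extends r B E d 1 {v}" using assms by (auto simp: no_chain_def)
  have "\<exists>Y\<subseteq>V. jigsaw_chain r E Y \<and> card Y = card {v} + d"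
  proof (rule extends_imp_jigsaw_chain[OF v(2)])
    show "{v} \<inter> B i = {}" if "1 \<le> i" for i
    proof -
      have "B 0 \<inter> B i = {}" using assms(2) that by (auto simp: disjoint_family_on_def)
      then show ?thesis using v by auto
    qed
  qed (use assms v in \<open>auto intro: jigsaw_chain.start\<close>)
  then show ?thesis by simp
qed

lemma extends_mono_blocks:
  assumes "extends r B' E d k X" "\<And>i. B' i \<subseteq> B i"
  shows "extends r B E d k X"
  using assms by (induction d arbitrary: k X) (auto, blast)

lemma extends_cong_edges:
  assumes "\<And>s x v. x \<in> X \<union> (\<Union>i\<in>{k..}. B i) \<Longrightarrow> v \<in> (\<Union>i\<in>{k..}. B i) \<Longrightarrow> {x, v} \<in> E s \<longleftrightarrow> {x, v} \<in> E' s"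
  shows "extends r B E d k X = extends r B E' d k X"
  using assms
proof (induction d arbitrary: k X)
  case (Suc d)
  have "joined r E X v = joined r E' X v" if "v \<in> B k" for v
    using Suc.prems that unfolding joined_def by (intro ball_cong bex_cong refl) auto
  moreover have "extends r B E d (Suc k) (insert v X) = extends r B E' d (Suc k) (insert v X)"
    if "v \<in> B k" for v
    by (rule Suc.IH, rule Suc.prems) (use that in \<open>auto intro: Suc_leD\<close>)
  ultimately show ?case by auto
qed simp

text \<open>Every edge examined from step \<open>k\<close> on has an end in a block
  \<open>B i\<close> with \<open>k \<le> i\<close>, so edges inside a set \<open>Z\<close> that
  misses these blocks are never examined. This separates the present step from its
  continuation.\<close>

lemma depends_on_extends:
  assumes "\<And>i. k \<le> i \<Longrightarrow> B i \<inter> Z = {}" and Q: "\<And>s e. (s, e) \<in> Q \<Longrightarrow> e \<subseteq> Z"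
  shows "depends_on (- Q) {\<omega>. extends r B (edges \<omega>) d k X}"
proof (rule depends_onI)
  fix f g :: "nat \<times> nat set \<Rightarrow> bool"
  assume eq: "\<And>x. x \<in> - Q \<Longrightarrow> f x = g x" and f: "f \<in> {\<omega>. extends r B (edges \<omega>) d k X}"
  have "extends r B (edges f) d k X = extends r B (edges g) d k X"
  proof (rule extends_cong_edges)
    fix s x v assume "v \<in> (\<Union>i\<in>{k..}. B i)"
    then have "(s, {x, v}) \<notin> Q" using assms(1) Q[of s "{x, v}"] by auto
    then show "{x, v} \<in> edges f s \<longleftrightarrow> {x, v} \<in> edges g s"
      using eq by (simp add: edges_def)
  qed
  with f show "g \<in> {\<omega>. extends r B (edges \<omega>) d k X}" by simp
qed

text \<open>A search from scratch examines only edges inside the blocks, so it ignores every edge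
  that meets \<open>Z\<close>. This separates the present chain, with \<open>Z = X\<close>, from a
  restart.\<close>

lemma depends_on_no_chain:
  assumes "\<And>i. B i \<inter> Z = {}" and Q: "\<And>s e. (s, e) \<in> Q \<Longrightarrow> e \<inter> Z \<noteq> {}"
  shows "depends_on (- Q) {\<omega>. no_chain r B (edges \<omega>) d}"
proof (rule depends_onI)
  fix f g :: "nat \<times> nat set \<Rightarrow> bool"
  assume eq: "\<And>x. x \<in> - Q \<Longrightarrow> f x = g x" and f: "f \<in> {\<omega>. no_chain r B (edges \<omega>) d}"
  have "extends r B (edges f) d 1 {u} = extends r B (edges g) d 1 {u}" if "u \<in> B 0" for u
  proof (rule extends_cong_edges)
    fix s x v assume "x \<in> {u} \<union> (\<Union>i\<in>{1..}. B i)" "v \<in> (\<Union>i\<in>{1..}. B i)"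
    then have "{x, v} \<inter> Z = {}" using assms(1) that by auto
    then have "(s, {x, v}) \<notin> Q" using Q by blast
    then show "{x, v} \<in> edges f s \<longleftrightarrow> {x, v} \<in> edges g s"
      using eq by (simp add: edges_def)
  qed
  with f show "g \<in> {\<omega>. no_chain r B (edges \<omega>) d}" by (simp add: no_chain_def)
qed

lemma depends_on_Collect_conj:
  "depends_on J {x. P x} \<Longrightarrow> depends_on J {x. Q x} \<Longrightarrow> depends_on J {x. P x \<and> Q x}"
  unfolding depends_on_def by blast

lemma depends_on_Collect_not:
  "depends_on J {x. P x} \<Longrightarrow> depends_on J {x. \<not> P x}"
  unfolding depends_on_def by (metis mem_Collect_eq)

text \<open>
  The set \<open>Q\<close> below contains the edges inspected in one step. Neither the continuation of the chain nor
  a restart after a failure inspects them again, since \<open>X\<close> is disjoint from all blocks.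
\<close>

lemma edge_prob_no_chain_step:
  assumes p: "p \<in> {1..r} \<rightarrow> {0..1}"
    and restart: "\<And>B. disjoint_family B \<Longrightarrow> (\<And>i. B i \<subseteq> {1..n}) \<Longrightarrow> (\<And>i. i \<le> D \<Longrightarrow> b i + M \<le> card (B i)) \<Longrightarrow>
        edge_prob r n p {\<omega>. no_chain r B (edges \<omega>) D} \<le> \<beta>"
    and B: "disjoint_family B" "\<And>i. B i \<subseteq> {1..n}" "\<And>i. i \<le> D \<Longrightarrow> b i + M \<le> card (B i)"
      "\<And>i. k \<le> i \<Longrightarrow> i \<le> D \<Longrightarrow> Suc (b i + M) \<le> card (B i)"
    and X: "X \<subseteq> {1..n}" "card X = k" "\<And>i. X \<inter> B i = {}" and d: "d + k = Suc D"
  shows "edge_prob r n p {\<omega>. \<not> extends r B (edges \<omega>) d k X \<and> no_chain r B (edges \<omega>) D} \<le>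
    (1 - (\<Prod>i=k..D. 1 - (1 - join_prob r p i) ^ b i)) * \<beta>"
  using B X d
proof (induction d arbitrary: k X B)
  case 0
  \<comment> \<open>With no step left the event is empty, and the bound is 0 because the product is
    empty for \<open>k = Suc D\<close>.\<close>
  then show ?case by simp
next
  case (Suc d)
  note B = Suc.prems(1-4) and X = Suc.prems(5-7)
  define \<phi> where "\<phi> i = 1 - (1 - join_prob r p i) ^ b i" for i
  define \<pi> where "\<pi> = (\<Prod>i=Suc k..D. \<phi> i)"
  define none where "none = {\<omega>. \<forall>v\<in>B k. \<not> joined r (edges \<omega>) X v}"
  \<comment> \<open>The candidate tried is the least one joined to \<open>X\<close>. This makes the
    events \<open>A v\<close> disjoint, so their probabilities sum to at most the probability that
    some candidate exists.\<close>
  define A where "A v = {\<omega>. joined r (edges \<omega>) X v \<and> (\<forall>u\<in>B k. u < v \<longrightarrow> \<not> joined r (edges \<omega>) X u)}" for v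
  \<comment> \<open>Removing \<open>v\<close> keeps the restart away from the chain. It uses up the
    one surplus vertex that the blocks from index \<open>k\<close> on still have by the assumption
    with \<open>Suc\<close>.\<close>
  define B' where "B' v = B(k := B k - {v})" for v
  define W where "W v = {\<omega>. \<not> extends r (B' v) (edges \<omega>) d (Suc k) (insert v X) \<and> no_chain r (B' v) (edges \<omega>) D}" for v
  define Q where "Q = (UNIV :: nat set) \<times> (\<Union>v\<in>B k. (\<lambda>x. {x, v}) ` X)"
  have kD: "k \<le> D" using Suc.prems(8) by simp
  have fB: "finite (B i)" for i using B(2) by (rule finite_subset) simp
  have fX: "finite X" using X(1) by (rule finite_subset) simp
  have B'_sub: "B' v i \<subseteq> B i" for v i by (auto simp: B'_def)
  have \<phi>: "0 \<le> \<phi> i" "\<phi> i \<le> 1" for i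
    using join_prob_bounds[OF p, of i] by (auto simp: \<phi>_def intro!: power_le_one)
  have \<pi>: "0 \<le> \<pi>" "\<pi> \<le> 1" unfolding \<pi>_def using \<phi> by (auto intro!: prod_nonneg prod_le_1)
  have \<beta>: "edge_prob r n p {\<omega>. no_chain r B (edges \<omega>) D} \<le> \<beta>" using restart B by blast
  then have "0 \<le> \<beta>" using measure_nonneg order_trans by blast
  have dep_joined: "depends_on Q {\<omega>. joined r (edges \<omega>) X v}" if "v \<in> B k" for v
    by (rule depends_on_mono[OF depends_on_joined]) (use that in \<open>auto simp: Q_def\<close>)
  have dep_none: "depends_on Q none"
  proof (rule depends_onI)
    fix f g :: "nat \<times> nat set \<Rightarrow> bool"
    assume "\<And>x. x \<in> Q \<Longrightarrow> f x = g x" and f: "f \<in> none"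
    then have "joined r (edges f) X v = joined r (edges g) X v" if "v \<in> B k" for v
      using depends_on_iff[OF dep_joined[OF that], of f g] by simp
    with f show "g \<in> none" by (simp add: none_def)
  qed
  have dep_A: "depends_on Q (A v)" if "v \<in> B k" for v
  proof (rule depends_onI)
    fix f g :: "nat \<times> nat set \<Rightarrow> bool"
    assume "\<And>x. x \<in> Q \<Longrightarrow> f x = g x" and f: "f \<in> A v"
    then have "joined r (edges f) X u = joined r (edges g) X u" if "u \<in> B k" for u
      using depends_on_iff[OF dep_joined[OF that], of f g] by simp
    with f that show "g \<in> A v" by (simp add: A_def)
  qed
  have dep_W: "depends_on (- Q) (W v)" if "v \<in> B k" for v
    unfolding W_def
  proof (intro depends_on_Collect_conj depends_on_Collect_not)
    show "depends_on (- Q) {\<omega>. extends r (B' v) (edges \<omega>) d (Suc k) (insert v X)}"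
    proof (rule depends_on_extends[where Z = "X \<union> B k"])
      fix i assume "Suc k \<le> i"
      then have "B i \<inter> B k = {}" using B(1) by (auto simp: disjoint_family_on_def)
      then show "B' v i \<inter> (X \<union> B k) = {}" using B'_sub[of v i] X(3)[of i] by blast
    qed (auto simp: Q_def)
    show "depends_on (- Q) {\<omega>. no_chain r (B' v) (edges \<omega>) D}"
    proof (rule depends_on_no_chain[where Z = X])
      show "B' v i \<inter> X = {}" for i using B'_sub[of v i] X(3)[of i] by blast
    qed (auto simp: Q_def)
  qed
  have W_le: "edge_prob r n p (W v) \<le> (1 - \<pi>) * \<beta>" if v: "v \<in> B k" for v
    unfolding W_def \<pi>_def \<phi>_def
  proof (rule Suc.IH)
    show "disjoint_family (B' v)"
      using B(1) B'_sub[of v] unfolding disjoint_family_on_def by blast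
    show "B' v i \<subseteq> {1..n}" for i using B(2)[of i] B'_sub[of v i] by blast
    show "b i + M \<le> card (B' v i)" if "i \<le> D" for i
      using B(3)[OF that] B(4)[of k] kD v fB[of k] by (auto simp: B'_def)
    show "Suc (b i + M) \<le> card (B' v i)" if "Suc k \<le> i" "i \<le> D" for i
      using B(4)[of i] that by (simp add: B'_def)
    show "insert v X \<subseteq> {1..n}" using X(1) v B(2)[of k] by auto
    show "card (insert v X) = Suc k" using X v fX by (subst card_insert_disjoint) auto
    show "insert v X \<inter> B' v i = {}" for i
    proof -
      have "v \<notin> B' v i"
        using B(1) v by (cases "i = k") (auto simp: B'_def disjoint_family_on_def)
      then show ?thesis using X(3)[of i] B'_sub[of v i] by blast
    qed
    show "d + Suc k = Suc D" using Suc.prems(8) by simp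
  qed
  \<comment> \<open>If no candidate exists, only a restart in the same blocks remains. Otherwise the
    chain through the least candidate also fails, and the absence of chains passes to the smaller
    blocks.\<close>
  have cover: "{\<omega>. \<not> extends r B (edges \<omega>) (Suc d) k X \<and> no_chain r B (edges \<omega>) D} \<subseteq>
    (none \<inter> {\<omega>. no_chain r B (edges \<omega>) D}) \<union> (\<Union>v\<in>B k. A v \<inter> W v)"
  proof
    fix \<omega> assume \<omega>: "\<omega> \<in> {\<omega>. \<not> extends r B (edges \<omega>) (Suc d) k X \<and> no_chain r B (edges \<omega>) D}"
    show "\<omega> \<in> (none \<inter> {\<omega>. no_chain r B (edges \<omega>) D}) \<union> (\<Union>v\<in>B k. A v \<inter> W v)"
    proof (cases "\<omega> \<in> none")
      case False
      define v where "v = (LEAST v. v \<in> B k \<and> joined r (edges \<omega>) X v)"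
      have v: "v \<in> B k \<and> joined r (edges \<omega>) X v"
        unfolding v_def by (rule LeastI_ex) (use False in \<open>auto simp: none_def\<close>)
      have "\<not> joined r (edges \<omega>) X u" if "u \<in> B k" "u < v" for u
        using not_less_Least[of u "\<lambda>v. v \<in> B k \<and> joined r (edges \<omega>) X v"] that unfolding v_def by blast
      then have "\<omega> \<in> A v" using v by (simp add: A_def)
      moreover have "\<not> extends r (B' v) (edges \<omega>) d (Suc k) (insert v X)"
        using \<omega> v extends_mono_blocks[OF _ B'_sub] by auto
      moreover have "no_chain r (B' v) (edges \<omega>) D"
        using \<omega> by (auto simp: no_chain_def dest!: extends_mono_blocks[OF _ B'_sub] subsetD[OF B'_sub])
      ultimately show ?thesis using v by (auto simp: W_def)
    qed (use \<omega> in auto)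
  qed
  have none: "edge_prob r n p none = (1 - join_prob r p k) ^ card (B k)"
    unfolding none_def using edge_prob_none_joined[OF p X(1) B(2) X(3)] X(2) by simp
  have sum_A: "(\<Sum>v\<in>B k. edge_prob r n p (A v)) \<le> 1 - edge_prob r n p none"
  proof -
    have "(\<Sum>v\<in>B k. edge_prob r n p (A v)) = edge_prob r n p (\<Union>v\<in>B k. A v)"
    proof (rule measure_pmf.finite_measure_finite_Union[symmetric])
      show "disjoint_family_on A (B k)"
        unfolding disjoint_family_on_def A_def using linorder_neq_iff by blast
    qed (use fB in auto)
    also have "\<dots> \<le> edge_prob r n p {\<omega>. \<omega> \<notin> none}"
      by (rule edge_prob_mono) (auto simp: A_def none_def)
    finally show ?thesis using edge_prob_compl[of r n p "\<lambda>\<omega>. \<omega> \<in> none"] by simp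
  qed
  have phi_le: "\<phi> k \<le> 1 - edge_prob r n p none"
  proof -
    have "b k \<le> card (B k)" using B(3)[OF kD] by simp
    then have "(1 - join_prob r p k) ^ card (B k) \<le> (1 - join_prob r p k) ^ b k"
      using join_prob_bounds[OF p, of k] by (intro power_decreasing) auto
    then show ?thesis by (simp add: none \<phi>_def)
  qed
  let ?N = "none \<inter> {\<omega>. no_chain r B (edges \<omega>) D}"
  let ?U = "\<Union>v\<in>B k. A v \<inter> W v"
  have N: "edge_prob r n p ?N \<le> edge_prob r n p none * \<beta>"
  proof -
    have "depends_on (- Q) {\<omega>. no_chain r B (edges \<omega>) D}"
      by (rule depends_on_no_chain[where Z = X]) (use X(3) in \<open>auto simp: Q_def\<close>)
    with dep_none have "edge_prob r n p ?N = edge_prob r n p none * edge_prob r n p {\<omega>. no_chain r B (edges \<omega>) D}"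
      by (rule edge_prob_Int)
    then show ?thesis using \<beta> by (simp add: mult_left_mono)
  qed
  have "edge_prob r n p ?U \<le> (\<Sum>v\<in>B k. edge_prob r n p (A v \<inter> W v))"
    by (rule edge_prob_UN_le[OF fB])
  also have "\<dots> = (\<Sum>v\<in>B k. edge_prob r n p (A v) * edge_prob r n p (W v))"
    by (intro sum.cong refl edge_prob_Int[OF dep_A dep_W])
  also have "\<dots> \<le> (\<Sum>v\<in>B k. edge_prob r n p (A v) * ((1 - \<pi>) * \<beta>))"
    by (intro sum_mono mult_left_mono W_le) auto
  also have "\<dots> \<le> (1 - edge_prob r n p none) * ((1 - \<pi>) * \<beta>)"
    unfolding sum_distrib_right[symmetric] using sum_A \<pi> \<open>0 \<le> \<beta>\<close> by (intro mult_right_mono) auto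
  finally have U: "edge_prob r n p ?U \<le> (1 - edge_prob r n p none) * ((1 - \<pi>) * \<beta>)" .
  have "edge_prob r n p {\<omega>. \<not> extends r B (edges \<omega>) (Suc d) k X \<and> no_chain r B (edges \<omega>) D}
    \<le> edge_prob r n p (?N \<union> ?U)"
    by (rule edge_prob_mono[OF cover])
  also have "\<dots> \<le> edge_prob r n p ?N + edge_prob r n p ?U"
    by (rule measure_Un_le) auto
  \<comment> \<open>With x the probability of \<open>none\<close>, the coefficient of
    \<open>\<beta>\<close> is x + (1 - x) (1 - \<open>\<pi>\<close>) = 1 - (1 - x)
    \<open>\<pi>\<close>.\<close>
  also have "\<dots> \<le> (1 - (1 - edge_prob r n p none) * \<pi>) * \<beta>"
    using N U by (simp add: algebra_simps)
  also have "\<dots> \<le> (1 - \<phi> k * \<pi>) * \<beta>"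
    using phi_le \<pi> \<open>0 \<le> \<beta>\<close> by (intro mult_right_mono diff_left_mono) auto
  also have "\<phi> k * \<pi> = (\<Prod>i=k..D. \<phi> i)"
    unfolding \<pi>_def using kD by (simp add: prod.atLeast_Suc_atMost)
  finally show ?case by (simp only: \<phi>_def)
qed

text \<open>Each trial spends at most one vertex per block, so \<open>M\<close> vertices of reserve
  per block pay for \<open>M\<close> trials, and every trial still sees \<open>b i\<close>
  candidates at step \<open>i\<close>. The induction hypothesis on \<open>M\<close> is the restart
  bound of the step lemma.\<close>

lemma edge_prob_no_chain:
  assumes p: "p \<in> {1..r} \<rightarrow> {0..1}"
    and B: "disjoint_family B" "\<And>i. B i \<subseteq> {1..n}" "\<And>i. i \<le> D \<Longrightarrow> b i + M \<le> card (B i)"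
  shows "edge_prob r n p {\<omega>. no_chain r B (edges \<omega>) D} \<le>
    (1 - (\<Prod>i=1..D. 1 - (1 - join_prob r p i) ^ b i)) ^ M"
  using B
proof (induction M arbitrary: B)
  case (Suc M)
  note B = Suc.prems
  have "0 < card (B 0)" using B(3)[of 0] by linarith
  then obtain v where v: "v \<in> B 0" by (metis card_gt_0_iff ex_in_conv)
  have fB: "finite (B i)" for i using B(2) by (rule finite_subset) simp
  define B' where "B' = B(0 := B 0 - {v})"
  have B'_sub: "B' i \<subseteq> B i" for i by (auto simp: B'_def)
  \<comment> \<open>A single start vertex \<open>v\<close> is set aside: the chain from
    \<open>v\<close> fails, and so does every chain in the remaining blocks.\<close>
  have "edge_prob r n p {\<omega>. no_chain r B (edges \<omega>) D} \<le>
    edge_prob r n p {\<omega>. \<not> extends r B' (edges \<omega>) D 1 {v} \<and> no_chain r B' (edges \<omega>) D}"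
    using v
    by (intro edge_prob_mono) (auto simp: no_chain_def dest!: extends_mono_blocks[OF _ B'_sub] subsetD[OF B'_sub])
  also have "\<dots> \<le> (1 - (\<Prod>i=1..D. 1 - (1 - join_prob r p i) ^ b i)) *
      (1 - (\<Prod>i=1..D. 1 - (1 - join_prob r p i) ^ b i)) ^ M"
  proof (rule edge_prob_no_chain_step[OF p Suc.IH])
    show "disjoint_family B'"
      using B(1) B'_sub unfolding disjoint_family_on_def by blast
    show "B' i \<subseteq> {1..n}" for i using B(2)[of i] B'_sub[of i] by blast
    show "b i + M \<le> card (B' i)" if "i \<le> D" for i
      using B(3)[OF that] v fB[of 0] by (auto simp: B'_def)
    show "Suc (b i + M) \<le> card (B' i)" if "1 \<le> i" "i \<le> D" for i
      using B(3)[of i] that by (simp add: B'_def)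
    show "{v} \<subseteq> {1..n}" using v B(2)[of 0] by auto
    show "{v} \<inter> B' i = {}" for i
      using B(1) v by (cases "i = 0") (auto simp: B'_def disjoint_family_on_def)
  qed auto
  finally show ?case by simp
qed simp

section \<open>Union bounds\<close>

text \<open>A spanning tree rooted at \<open>x\<close> is encoded by its parent map. Injectivity of
  the map from a vertex to its parent edge yields \<open>card S - 1\<close> different edges; without
  it two vertices could be each other's parents. A maximal tree covers \<open>S\<close>, since
  connectedness supplies an edge leaving any smaller one.\<close>

lemma connected_on_imp_parent_map:
  assumes fin: "finite S" and x: "x \<in> S" and conn: "connected_on E S"
  shows "\<exists>f\<in>(S - {x}) \<rightarrow>\<^sub>E S. inj_on (\<lambda>v. {v, f v}) (S - {x}) \<and> (\<forall>v\<in>S - {x}. f v \<noteq> v \<and> {v, f v} \<in> E)"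
proof -
  define tree where "tree A f \<longleftrightarrow> inj_on (\<lambda>v. {v, f v}) (A - {x}) \<and>
    (\<forall>v\<in>A - {x}. f v \<in> A \<and> f v \<noteq> v \<and> {v, f v} \<in> E)" for A f
  define F where "F = {A. A \<subseteq> S \<and> x \<in> A \<and> (\<exists>f. tree A f)}"
  have "finite F" by (rule finite_subset[of _ "Pow S"]) (use fin in \<open>auto simp: F_def\<close>)
  moreover have "{x} \<in> F" using x by (auto simp: F_def tree_def)
  ultimately obtain A where A: "A \<in> F" and max: "\<And>B. B \<in> F \<Longrightarrow> A \<subseteq> B \<Longrightarrow> A = B"
    using finite_has_maximal[of F] by blast
  then obtain f where f: "tree A f" and AS: "A \<subseteq> S" "x \<in> A" by (auto simp: F_def)
  have "A = S"
  proof (rule ccontr)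
    assume "A \<noteq> S"
    then obtain u v where uv: "u \<in> A" "v \<in> S" "v \<notin> A" "{u, v} \<in> E"
      using connected_onD[OF conn, of A] AS by blast
    let ?g = "f(v := u)"
    have eq: "insert v A - {x} = insert v (A - {x})" using uv AS by auto
    have "inj_on (\<lambda>w. {w, ?g w}) (insert v (A - {x}))"
    proof (subst inj_on_insert, intro conjI)
      have "inj_on (\<lambda>w. {w, ?g w}) (A - {x}) \<longleftrightarrow> inj_on (\<lambda>w. {w, f w}) (A - {x})"
        using uv by (intro inj_on_cong) auto
      then show "inj_on (\<lambda>w. {w, ?g w}) (A - {x})" using f by (simp add: tree_def)
      \<comment> \<open>The new edge contains \<open>v\<close>, which lies on none of the old tree
        edges.\<close>
      have "{v, u} \<noteq> {w, f w}" if "w \<in> A - {x}" for w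
      proof -
        have "v \<notin> {w, f w}" using f that uv by (auto simp: tree_def)
        then show ?thesis by auto
      qed
      then show "{v, ?g v} \<notin> (\<lambda>w. {w, ?g w}) ` (A - {x} - {v})" by auto
    qed
    then have "tree (insert v A) ?g"
      unfolding tree_def eq using f uv by (auto simp: tree_def insert_commute)
    then have "insert v A \<in> F" using AS uv by (auto simp: F_def)
    then show False using max uv by blast
  qed
  with f have f: "tree S f" by simp
  have "inj_on (\<lambda>v. {v, restrict f (S - {x}) v}) (S - {x}) \<longleftrightarrow> inj_on (\<lambda>v. {v, f v}) (S - {x})"
    by (intro inj_on_cong) auto
  then show ?thesis
    using f by (intro bexI[of _ "restrict f (S - {x})"]) (auto simp: tree_def)
qed

text \<open>Union bound over parent maps. Counting all maps from \<open>S - {x}\<close> to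
  \<open>S\<close> is cruder than counting trees, but costs only a factor
  \<open>card S\<close>.\<close>

lemma edge_prob_connected_on_le:
  assumes p: "p \<in> {1..r} \<rightarrow> {0..1}" and s: "s \<in> {1..r}" and S: "S \<subseteq> {1..n}" "S \<noteq> {}"
  shows "edge_prob r n p {\<omega>. connected_on (edges \<omega> s) S} \<le> (real (card S) * p s) ^ (card S - 1)"
proof -
  have fS: "finite S" using S(1) by (rule finite_subset) simp
  obtain x where x: "x \<in> S" using S by auto
  define T where "T = {f \<in> (S - {x}) \<rightarrow>\<^sub>E S. inj_on (\<lambda>v. {v, f v}) (S - {x}) \<and> (\<forall>v\<in>S - {x}. f v \<noteq> v)}"
  have fP: "finite ((S - {x}) \<rightarrow>\<^sub>E S)" using fS by (intro finite_PiE) auto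
  have fT: "finite T" by (rule finite_subset[OF _ fP]) (auto simp: T_def)
  let ?F = "\<lambda>f. (\<lambda>v. {v, f v}) ` (S - {x})"
  have ps: "p s \<in> {0..1}" using p s by (rule funcset_mem)
  then have p0: "0 \<le> p s" by simp
  have "{\<omega>. connected_on (edges \<omega> s) S} \<subseteq> (\<Union>f\<in>T. {\<omega>. \<forall>e\<in>?F f. \<omega> (s, e)})"
  proof
    fix \<omega> assume "\<omega> \<in> {\<omega>. connected_on (edges \<omega> s) S}"
    then have "connected_on (edges \<omega> s) S" by simp
    from connected_on_imp_parent_map[OF fS x this]
    show "\<omega> \<in> (\<Union>f\<in>T. {\<omega>. \<forall>e\<in>?F f. \<omega> (s, e)})"
      unfolding T_def edges_def by blast
  qed
  then have "edge_prob r n p {\<omega>. connected_on (edges \<omega> s) S}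
    \<le> edge_prob r n p (\<Union>f\<in>T. {\<omega>. \<forall>e\<in>?F f. \<omega> (s, e)})"
    by (rule edge_prob_mono)
  also have "\<dots> \<le> (\<Sum>f\<in>T. edge_prob r n p {\<omega>. \<forall>e\<in>?F f. \<omega> (s, e)})"
    by (rule edge_prob_UN_le[OF fT])
  also have "\<dots> = (\<Sum>f\<in>T. p s ^ (card S - 1))"
  proof (rule sum.cong)
    fix f assume f: "f \<in> T"
    then have "card (?F f) = card S - 1" using x fS by (simp add: T_def card_image)
    moreover have "{v, f v} \<in> vertex_pairs {1..n}" if "v \<in> S - {x}" for v
    proof -
      have "f v \<noteq> v" "f v \<in> S" using f that by (auto simp: T_def)
      then show ?thesis using that S by (auto simp: vertex_pairs_def)
    qed
    then have "?F f \<subseteq> vertex_pairs {1..n}" by blast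
    ultimately show "edge_prob r n p {\<omega>. \<forall>e\<in>?F f. \<omega> (s, e)} = p s ^ (card S - 1)"
      using edge_prob_all_edges[of s r "?F f" n p] s ps by simp
  qed simp
  also have "\<dots> = real (card T) * p s ^ (card S - 1)" by simp
  also have "\<dots> \<le> real (card S) ^ (card S - 1) * p s ^ (card S - 1)"
  proof (rule mult_right_mono)
    have "card T \<le> card ((S - {x}) \<rightarrow>\<^sub>E S)"
      by (rule card_mono[OF fP]) (auto simp: T_def)
    also have "\<dots> = card S ^ (card S - 1)" using fS x by (simp add: card_PiE)
    finally show "real (card T) \<le> real (card S) ^ (card S - 1)" by (metis of_nat_le_iff of_nat_power)
  qed (use p0 in simp)
  finally show ?thesis by (simp add: power_mult_distrib)
qed

lemma edge_prob_all_connected_on_le: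
  assumes p: "p \<in> {1..r} \<rightarrow> {0..1}" and i: "i \<le> r" and S: "S \<subseteq> {1..n}" "card S = k" "0 < k"
  shows "edge_prob r n p {\<omega>. \<forall>s\<in>{1..i}. connected_on (edges \<omega> s) S} \<le> (real k ^ i * (\<Prod>s=1..i. p s)) ^ (k - 1)"
proof -
  let ?A = "\<lambda>s. {\<omega>. connected_on (edges \<omega> s) S}"
  have "{\<omega>. \<forall>s\<in>{1..i}. connected_on (edges \<omega> s) S} = (\<Inter>s\<in>{1..i}. ?A s)" by auto
  also have "edge_prob r n p \<dots> = (\<Prod>s=1..i. edge_prob r n p (?A s))"
    by (rule edge_prob_INT[where J = "\<lambda>s. {s} \<times> UNIV"]) (auto intro!: depends_onI simp: edges_def)
  also have "\<dots> \<le> (\<Prod>s=1..i. (real k * p s) ^ (k - 1))"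
  proof (intro prod_mono conjI)
    fix s assume "s \<in> {1..i}"
    then show "edge_prob r n p (?A s) \<le> (real k * p s) ^ (k - 1)"
      using S i edge_prob_connected_on_le[OF p, of s S n] by (cases "S = {}") auto
  qed simp
  also have "\<dots> = (real k ^ i * (\<Prod>s=1..i. p s)) ^ (k - 1)"
    by (simp add: prod.distrib flip: prod_power_distrib)
  finally show ?thesis .
qed

text \<open>Discarding the colours after \<open>i\<close> makes the bound depend on the one prefix
  product that is assumed to be small.\<close>

lemma edge_prob_percolates_le:
  assumes p: "p \<in> {1..r} \<rightarrow> {0..1}" and i: "i \<le> r" and m: "1 < m" "m \<le> n"
  shows "edge_prob r n p {\<omega>. percolates r ({1..n}, edges \<omega>)} \<le>
    (\<Sum>k=m..2*m. real (n choose k) * (real k ^ i * (\<Prod>s=1..i. p s)) ^ (k - 1))"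
proof -
  let ?\<S> = "\<lambda>k. {S. S \<subseteq> {1..n} \<and> card S = k}"
  let ?A = "\<lambda>S. {\<omega>. \<forall>s\<in>{1..i}. connected_on (edges \<omega> s) S}"
  have "{\<omega>. percolates r ({1..n}, edges \<omega>)} \<subseteq> (\<Union>k\<in>{m..2*m}. \<Union>S\<in>?\<S> k. ?A S)"
  proof
    fix \<omega> assume "\<omega> \<in> {\<omega>. percolates r ({1..n}, edges \<omega>)}"
    then have "percolates r ({1..n}, edges \<omega>)" by simp
    from percolates_imp_medium_connected[OF _ this m(1)] m
    obtain S where "S \<subseteq> {1..n}" "m \<le> card S" "card S \<le> 2 * m" "\<forall>s\<in>{1..r}. connected_on (edges \<omega> s) S"
      by auto
    with i show "\<omega> \<in> (\<Union>k\<in>{m..2*m}. \<Union>S\<in>?\<S> k. ?A S)"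
      by (intro UN_I[of "card S"] UN_I[of S]) auto
  qed
  then have "edge_prob r n p {\<omega>. percolates r ({1..n}, edges \<omega>)} \<le> edge_prob r n p (\<Union>k\<in>{m..2*m}. \<Union>S\<in>?\<S> k. ?A S)"
    by (rule edge_prob_mono)
  also have "\<dots> \<le> (\<Sum>k=m..2*m. edge_prob r n p (\<Union>S\<in>?\<S> k. ?A S))"
    by (rule edge_prob_UN_le) simp
  also have "\<dots> \<le> (\<Sum>k=m..2*m. real (n choose k) * (real k ^ i * (\<Prod>s=1..i. p s)) ^ (k - 1))"
  proof (rule sum_mono)
    fix k assume k: "k \<in> {m..2*m}"
    have "edge_prob r n p (\<Union>S\<in>?\<S> k. ?A S) \<le> (\<Sum>S\<in>?\<S> k. edge_prob r n p (?A S))"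
      by (rule edge_prob_UN_le) simp
    also have "\<dots> \<le> (\<Sum>S\<in>?\<S> k. (real k ^ i * (\<Prod>s=1..i. p s)) ^ (k - 1))"
      using edge_prob_all_connected_on_le[OF p i] k m by (intro sum_mono) auto
    also have "\<dots> = real (n choose k) * (real k ^ i * (\<Prod>s=1..i. p s)) ^ (k - 1)"
      by (simp add: n_subsets)
    finally show "edge_prob r n p (\<Union>S\<in>?\<S> k. ?A S) \<le> real (n choose k) * (real k ^ i * (\<Prod>s=1..i. p s)) ^ (k - 1)" .
  qed
  finally show ?thesis .
qed

text \<open>Searching for an isolated vertex only among the first \<open>a\<close> vertices avoids a
  second moment argument. Unless there is an edge among them, each must have a neighbour outside,
  and these \<open>a\<close> events involve disjoint sets of edges.\<close>

lemma edge_prob_percolates_le_isolated: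
  assumes p: "p \<in> {1..r} \<rightarrow> {0..1}" and r: "1 \<le> r" and a: "a \<le> n" and n: "2 \<le> n"
  shows "edge_prob r n p {\<omega>. percolates r ({1..n}, edges \<omega>)} \<le>
    real a ^ 2 * p 1 + (1 - (1 - p 1) ^ (n - a)) ^ a"
proof -
  let ?A = "{1..a}" and ?B = "{a+1..n}"
  let ?in = "\<lambda>(x, y). {\<omega>. x \<noteq> y \<and> \<omega> (1, {x, y})}"
  have p1: "p 1 \<in> {0..1}" using funcset_mem[OF p, of 1] r by auto
  have "{\<omega>. percolates r ({1..n}, edges \<omega>)} \<subseteq>
    (\<Union>e\<in>?A \<times> ?A. ?in e) \<union> (\<Inter>v\<in>?A. {\<omega>. joined 1 (edges \<omega>) ?B v})"
  proof
    fix \<omega> assume "\<omega> \<in> {\<omega>. percolates r ({1..n}, edges \<omega>)}"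
    then have "percolates r ({1..n}, edges \<omega>)" by simp
    \<comment> \<open>For size \<open>n\<close> the connected set can only be the whole vertex
      set.\<close>
    from percolates_imp_medium_connected[OF _ this, of n] n
    obtain S where S: "S \<subseteq> {1..n}" "n \<le> card S" "\<forall>s\<in>{1..r}. connected_on (edges \<omega> s) S" by auto
    then have "S = {1..n}" by (intro card_seteq) auto
    with S r have conn: "connected_on (edges \<omega> 1) {1..n}" by auto
    show "\<omega> \<in> (\<Union>e\<in>?A \<times> ?A. ?in e) \<union> (\<Inter>v\<in>?A. {\<omega>. joined 1 (edges \<omega>) ?B v})"
    proof (rule ccontr)
      assume *: "\<not> ?thesis"
      then obtain v where v: "v \<in> ?A" "\<not> joined 1 (edges \<omega>) ?B v" by blast
      have "{v} \<noteq> {1..n}" using n by (metis card_1_singleton_iff card_atLeastAtMost diff_Suc_1 One_nat_def Suc_1 Suc_n_not_le_n)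
      moreover have "{v} \<subseteq> {1..n}" using v a by auto
      ultimately obtain u where u: "u \<in> {1..n}" "u \<noteq> v" "{v, u} \<in> edges \<omega> 1"
        using connected_onD[OF conn, of "{v}"] by blast
      show False
      proof (cases "u \<in> ?A")
        case True
        with u v have "(v, u) \<in> ?A \<times> ?A" "\<omega> \<in> ?in (v, u)" by (auto simp: edges_def)
        with * show False by blast
      next
        case False
        with u v show False by (auto simp: joined_def insert_commute)
      qed
    qed
  qed
  then have "edge_prob r n p {\<omega>. percolates r ({1..n}, edges \<omega>)} \<le>
    edge_prob r n p ((\<Union>e\<in>?A \<times> ?A. ?in e) \<union> (\<Inter>v\<in>?A. {\<omega>. joined 1 (edges \<omega>) ?B v}))"
    by (rule edge_prob_mono)
  also have "\<dots> \<le> edge_prob r n p (\<Union>e\<in>?A \<times> ?A. ?in e) + edge_prob r n p (\<Inter>v\<in>?A. {\<omega>. joined 1 (edges \<omega>) ?B v})"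
    by (rule measure_Un_le) auto
  also have "edge_prob r n p (\<Union>e\<in>?A \<times> ?A. ?in e) \<le> (\<Sum>e\<in>?A \<times> ?A. edge_prob r n p (?in e))"
    by (rule edge_prob_UN_le) simp
  also have "\<dots> \<le> (\<Sum>e\<in>?A \<times> ?A. p 1)"
  proof (rule sum_mono)
    fix e assume e: "e \<in> ?A \<times> ?A"
    then obtain x y where xy: "e = (x, y)" "x \<in> ?A" "y \<in> ?A" by blast
    show "edge_prob r n p (?in e) \<le> p 1"
    proof (cases "x = y")
      case True
      then show ?thesis using xy p1 by simp
    next
      case False
      then have "{x, y} \<in> vertex_pairs {1..n}" using xy a by (auto simp: vertex_pairs_def)
      then show ?thesis using edge_prob_edge[of 1 r "{x, y}" n p] p1 r xy False by simp
    qed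
  qed
  also have "\<dots> = real a ^ 2 * p 1" by (simp add: power2_eq_square)
  also have "edge_prob r n p (\<Inter>v\<in>?A. {\<omega>. joined 1 (edges \<omega>) ?B v}) =
    (\<Prod>v\<in>?A. edge_prob r n p {\<omega>. joined 1 (edges \<omega>) ?B v})"
    by (rule edge_prob_INT[OF _ depends_on_joined]) (auto simp: doubleton_eq_iff)
  also have "\<dots> = (\<Prod>v\<in>?A. 1 - (1 - p 1) ^ (n - a))"
    using a by (intro prod.cong refl) (subst edge_prob_joined[OF p r], auto simp: join_prob_def)
  finally show ?thesis by simp
qed

lemma edge_prob_stuck_le:
  assumes p: "p \<in> {1..r} \<rightarrow> {0..1}"
  shows "edge_prob r n p {\<omega>. \<exists>S\<subseteq>{1..n}. K \<le> card S \<and> S \<noteq> {1..n} \<and> (\<forall>v\<in>{1..n} - S. \<not> joined r (edges \<omega>) S v)}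
    \<le> (\<Sum>k=K..<n. real (n choose k) * (1 - join_prob r p k) ^ (n - k))"
proof -
  let ?\<S> = "\<lambda>k. {S. S \<subseteq> {1..n} \<and> card S = k}"
  let ?A = "\<lambda>S. {\<omega>. \<forall>v\<in>{1..n} - S. \<not> joined r (edges \<omega>) S v}"
  have "{\<omega>. \<exists>S\<subseteq>{1..n}. K \<le> card S \<and> S \<noteq> {1..n} \<and> (\<forall>v\<in>{1..n} - S. \<not> joined r (edges \<omega>) S v)}
    \<subseteq> (\<Union>k\<in>{K..<n}. \<Union>S\<in>?\<S> k. ?A S)"
  proof
    fix \<omega> assume "\<omega> \<in> {\<omega>. \<exists>S\<subseteq>{1..n}. K \<le> card S \<and> S \<noteq> {1..n} \<and> (\<forall>v\<in>{1..n} - S. \<not> joined r (edges \<omega>) S v)}"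
    then obtain S where S: "S \<subseteq> {1..n}" "K \<le> card S" "S \<noteq> {1..n}" "\<omega> \<in> ?A S" by auto
    then have "card S < n" using psubset_card_mono[of "{1..n}" S] by auto
    with S show "\<omega> \<in> (\<Union>k\<in>{K..<n}. \<Union>S\<in>?\<S> k. ?A S)"
      by (intro UN_I[of "card S"] UN_I[of S]) auto
  qed
  then have "edge_prob r n p {\<omega>. \<exists>S\<subseteq>{1..n}. K \<le> card S \<and> S \<noteq> {1..n} \<and> (\<forall>v\<in>{1..n} - S. \<not> joined r (edges \<omega>) S v)}
    \<le> edge_prob r n p (\<Union>k\<in>{K..<n}. \<Union>S\<in>?\<S> k. ?A S)"
    by (rule edge_prob_mono)
  also have "\<dots> \<le> (\<Sum>k=K..<n. edge_prob r n p (\<Union>S\<in>?\<S> k. ?A S))"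
    by (rule edge_prob_UN_le) simp
  also have "\<dots> \<le> (\<Sum>k=K..<n. real (n choose k) * (1 - join_prob r p k) ^ (n - k))"
  proof (rule sum_mono)
    fix k
    have "edge_prob r n p (\<Union>S\<in>?\<S> k. ?A S) \<le> (\<Sum>S\<in>?\<S> k. edge_prob r n p (?A S))"
      by (rule edge_prob_UN_le) simp
    also have "\<dots> = (\<Sum>S\<in>?\<S> k. (1 - join_prob r p k) ^ (n - k))"
    proof (rule sum.cong)
      fix S assume S: "S \<in> ?\<S> k"
      then have "finite S" using finite_subset by blast
      with S have "card ({1..n} - S) = n - k" by (simp add: card_Diff_subset)
      then show "edge_prob r n p (?A S) = (1 - join_prob r p k) ^ (n - k)"
        using S by (subst edge_prob_none_joined[OF p]) auto
    qed simp
    also have "\<dots> = real (n choose k) * (1 - join_prob r p k) ^ (n - k)" by (simp add: n_subsets)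
    finally show "edge_prob r n p (\<Union>S\<in>?\<S> k. ?A S) \<le> real (n choose k) * (1 - join_prob r p k) ^ (n - k)" .
  qed
  finally show ?thesis .
qed

lemma edge_prob_not_percolates_le:
  assumes p: "p \<in> {1..r} \<rightarrow> {0..1}"
    and B: "disjoint_family B" "\<And>i. B i \<subseteq> {1..n}" "\<And>i. i \<le> D \<Longrightarrow> b i + M \<le> card (B i)"
  shows "edge_prob r n p {\<omega>. \<not> percolates r ({1..n}, edges \<omega>)} \<le>
    (1 - (\<Prod>i=1..D. 1 - (1 - join_prob r p i) ^ b i)) ^ M +
    (\<Sum>k=Suc D..<n. real (n choose k) * (1 - join_prob r p k) ^ (n - k))"
proof -
  let ?F = "{\<omega>. no_chain r B (edges \<omega>) D}"
  let ?S = "{\<omega>. \<exists>S\<subseteq>{1..n}. Suc D \<le> card S \<and> S \<noteq> {1..n} \<and> (\<forall>v\<in>{1..n} - S. \<not> joined r (edges \<omega>) S v)}"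
  have "{\<omega>. \<not> percolates r ({1..n}, edges \<omega>)} \<subseteq> ?F \<union> ?S"
  proof (intro subsetI, rule ccontr)
    fix \<omega> assume \<omega>: "\<omega> \<in> {\<omega>. \<not> percolates r ({1..n}, edges \<omega>)}" "\<omega> \<notin> ?F \<union> ?S"
    then have "\<not> no_chain r B (edges \<omega>) D" by simp
    from not_no_chainD[OF this B(1,2)] obtain Y where
      Y: "Y \<subseteq> {1..n}" "jigsaw_chain r (edges \<omega>) Y" "card Y = Suc D" by blast
    have "percolates r ({1..n}, edges \<omega>)"
      by (rule percolates_if_no_stuck_set[of _ _ Y "Suc D"]) (use Y \<omega>(2) in auto)
    with \<omega> show False by simp
  qed
  then have "edge_prob r n p {\<omega>. \<not> percolates r ({1..n}, edges \<omega>)} \<le> edge_prob r n p (?F \<union> ?S)"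
    by (rule edge_prob_mono)
  also have "\<dots> \<le> edge_prob r n p ?F + edge_prob r n p ?S" by (rule measure_Un_le) auto
  also have "\<dots> \<le> (1 - (\<Prod>i=1..D. 1 - (1 - join_prob r p i) ^ b i)) ^ M +
    (\<Sum>k=Suc D..<n. real (n choose k) * (1 - join_prob r p k) ^ (n - k))"
    by (intro add_mono edge_prob_no_chain edge_prob_stuck_le p B)
  finally show ?thesis .
qed

section \<open>The subcritical regime\<close>

text \<open>One term of the exponential series gives k^k \<le> e^k k!, and the factorial is absorbed
  by the binomial coefficient.\<close>

lemma binomial_times_power_le:
  "real (n choose k) * real k ^ k \<le> (exp 1 * real n) ^ k"
proof (cases "k \<le> n")
  case True
  have "real k ^ k / fact k \<le> exp (real k)"
  proof -
    have "(\<Sum>i\<in>{k}. inverse (fact i) *\<^sub>R real k ^ i) \<le> (\<Sum>i. inverse (fact i) *\<^sub>R real k ^ i)"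
      by (rule sum_le_suminf) (auto intro: summable_exp)
    then show ?thesis by (simp add: exp_def divide_inverse mult.commute)
  qed
  then have k: "real k ^ k \<le> exp 1 ^ k * fact k"
    by (simp add: field_simps flip: exp_of_nat_mult)
  have "real (n choose k) * fact k \<le> real n ^ k"
    using binomial_fact_pow[of n k] by (metis of_nat_fact of_nat_le_iff of_nat_mult of_nat_power)
  then have "exp 1 ^ k * (real (n choose k) * fact k) \<le> exp 1 ^ k * real n ^ k"
    by (intro mult_left_mono) auto
  moreover have "real (n choose k) * real k ^ k \<le> real (n choose k) * (exp 1 ^ k * fact k)"
    using k by (intro mult_left_mono) auto
  ultimately have "real (n choose k) * real k ^ k \<le> exp 1 ^ k * real n ^ k"
    by (simp only: mult.left_commute[of _ "exp 1 ^ k"])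
  then show ?thesis by (simp add: power_mult_distrib)
qed (simp add: binomial_eq_0)

text \<open>The sizes in question lie between L and 4 L. There 4^r in \<open>C\<close> absorbs
  k^(i-1) against L^(i-1), and exp 5 outweighs the factor e^k from choosing the set: each term is at
  most n exp (5 - 4 k) \<le> exp 5 / n^3, and there are at most n terms.\<close>

lemma edge_prob_percolates_le_connected:
  assumes p: "p \<in> {1..r} \<rightarrow> {0..1}" and i: "i \<in> {2..r}"
    and n: "1 \<le> ln (real n)" "nat \<lceil>ln (real n)\<rceil> < n" "2 \<le> nat \<lceil>ln (real n)\<rceil>"
    and C: "exp 5 * 4 ^ r \<le> C"
    and P: "(\<Prod>s=1..i. p s) \<le> 1 / (C * real n * ln (real n) ^ (i - 1))"
  shows "edge_prob r n p {\<omega>. percolates r ({1..n}, edges \<omega>)} \<le> exp 5 / real n ^ 2"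
proof -
  define L where "L = ln (real n)"
  define m where "m = nat \<lceil>L\<rceil>"
  define P where "P = (\<Prod>s=1..i. p s)"
  have L: "1 \<le> L" using n L_def by simp
  have n0: "0 < real n" using n by simp
  have expL: "exp L = real n" using n0 by (simp add: L_def)
  have m: "2 \<le> m" "m < n" "L \<le> real m" "real m \<le> L + 1" using n L by (auto simp: m_def L_def) 
  have P0: "0 \<le> P" unfolding P_def using p i by (auto intro!: prod_nonneg simp: Pi_iff)
  have C0: "0 < C" using C by (smt (verit) exp_gt_zero zero_less_mult_iff zero_less_power)
  have "edge_prob r n p {\<omega>. percolates r ({1..n}, edges \<omega>)} \<le>
    (\<Sum>k=m..2*m. real (n choose k) * (real k ^ i * P) ^ (k - 1))"
    unfolding P_def using i m by (intro edge_prob_percolates_le[OF p]) auto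
  also have "\<dots> \<le> (\<Sum>k=m..2*m. exp 5 / real n ^ 3)"
  proof (rule sum_mono)
    fix k assume k: "k \<in> {m..2*m}"
    have k1: "1 \<le> k" and kL: "L \<le> real k" "real k \<le> 4 * L" using k m L by auto
    obtain j where j: "k = Suc j" using k1 by (cases k) auto
    have "real k ^ (i - 1) \<le> (4 * L) ^ (i - 1)" using kL by (intro power_mono) auto
    also have "\<dots> \<le> 4 ^ r * L ^ (i - 1)"
      unfolding power_mult_distrib using i L by (intro mult_right_mono power_increasing) auto
    finally have kp: "real k ^ (i - 1) \<le> 4 ^ r * L ^ (i - 1)" .
    have "real k ^ (i - 1) * P \<le> (4 ^ r * L ^ (i - 1)) * (1 / (C * real n * L ^ (i - 1)))"
      using kp P P0 L by (intro mult_mono) (auto simp: P_def L_def)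
    also have "\<dots> = 4 ^ r / C / real n" using L by simp
    also have "\<dots> \<le> exp (- 5) / real n"
      using C C0 n0 by (intro divide_right_mono) (auto simp: field_simps exp_minus)
    finally have "real k * (real k ^ (i - 1) * P) \<le> real k * (exp (- 5) / real n)"
      by (intro mult_left_mono) auto
    then have "real k ^ i * P \<le> real k * (exp (- 5) / real n)"
      using i by (cases i) (auto simp: algebra_simps)
    then have "(real k ^ i * P) ^ j \<le> (real k * (exp (- 5) / real n)) ^ j"
      using P0 by (intro power_mono) auto
    then have "real (n choose k) * (real k ^ i * P) ^ j \<le> real (n choose k) * (real k * (exp (- 5) / real n)) ^ j"
      by (intro mult_left_mono) auto
    also have "\<dots> = real (n choose k) * real k ^ j * (exp (- 5) ^ j / real n ^ j)"
      by (simp add: power_mult_distrib power_divide)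
    also have "\<dots> \<le> real (n choose k) * real k ^ k * (exp (- 5) ^ j / real n ^ j)"
      using k1 j by (intro mult_right_mono mult_left_mono power_increasing) auto
    also have "\<dots> \<le> (exp 1 * real n) ^ k * (exp (- 5) ^ j / real n ^ j)"
      by (intro mult_right_mono binomial_times_power_le) auto
    also have "\<dots> = real n * (exp 1 ^ k * exp (- 5) ^ j)"
      using n0 by (simp add: j power_mult_distrib)
    also have "exp 1 ^ k * exp (- 5) ^ j = exp (5 - 4 * real k)"
      by (simp add: j flip: exp_of_nat_mult exp_add)
    also have "\<dots> \<le> exp (5 - 4 * L)" using kL by simp
    also have "\<dots> = exp 5 / real n ^ 4"
      using exp_of_nat_mult[of 4 L] by (simp add: exp_diff expL)
    finally show "real (n choose k) * (real k ^ i * P) ^ (k - 1) \<le> exp 5 / real n ^ 3"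
      using n0 j by (simp add: mult_left_mono power_eq_if)
  qed
  also have "\<dots> = real (m + 1) * (exp 5 / real n ^ 3)" by simp
  also have "\<dots> \<le> real n * (exp 5 / real n ^ 3)" using m by (intro mult_right_mono) auto
  also have "\<dots> = exp 5 / real n ^ 2" using n0 by (simp add: power_eq_if)
  finally show ?thesis .
qed

lemma one_minus_power_le_exp:
  fixes x :: real
  assumes "x \<le> 1"
  shows "(1 - x) ^ k \<le> exp (- (real k * x))"
proof -
  have "(1 - x) ^ k \<le> exp (- x) ^ k"
    using assms exp_ge_add_one_self[of "- x"] by (intro power_mono) auto
  then show ?thesis by (simp flip: exp_of_nat_mult)
qed

text \<open>With \<open>a\<close> of order n^(1/4) an edge among the chosen vertices is unlikely. By
  \<open>16 \<le> C\<close>, each of them has no outside neighbour with probability at least exp (-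
  L / 8) = n^(-1/8), so about n^(1/8) such vertices are to be expected.\<close>

lemma edge_prob_percolates_le_sparse:
  assumes p: "p \<in> {1..r} \<rightarrow> {0..1}" and r: "1 \<le> r"
    and n: "0 < ln (real n)" "2 \<le> n" "ln (real n) \<le> real n" and C: "16 \<le> C"
    and P: "p 1 \<le> ln (real n) / (C * real n)"
  shows "edge_prob r n p {\<omega>. percolates r ({1..n}, edges \<omega>)} \<le>
    sqrt (real n) * ln (real n) / real n + exp (- ((real n powr (1 / 4) - 1) * exp (- ln (real n) / 8)))"
proof -
  define L where "L = ln (real n)"
  define a where "a = nat \<lfloor>real n powr (1 / 4)\<rfloor>"
  have n0: "0 < real n" using n by simp
  have "p 1 \<in> {0..1}" using p r by (auto simp: Pi_iff)
  then have p1: "0 \<le> p 1" "p 1 \<le> 1" by auto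
  have "p 1 \<le> L / (16 * real n)"
    using P divide_left_mono[of "16 * real n" "C * real n" L] C n n0
    by (simp add: L_def)
  then have pn: "16 * (p 1 * real n) \<le> L" using n0 by (simp add: field_simps)
  moreover have "0 \<le> p 1 * real n" using p1 by simp
  ultimately have "p 1 * real n \<le> L" by linarith
  then have p2: "p 1 \<le> L / real n" using n0 by (simp add: field_simps)
  have "p 1 * real n \<le> 1 / 2 * real n" using pn n n0 unfolding L_def by linarith
  then have p3: "p 1 \<le> 1 / 2" using n0 by (simp only: mult_le_cancel_right_pos)
  have a: "real a \<le> real n powr (1 / 4)" "real n powr (1 / 4) - 1 \<le> real a"
    by (auto simp: a_def)
  have "real n powr (1 / 4) \<le> real n powr 1" using n by (intro powr_mono) auto
  then have an: "a \<le> n" using a n0 by simp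
  have "exp (- (2 * p 1)) \<le> 1 - p 1"
  proof -
    have "exp (- (2 * p 1)) = 1 / exp (2 * p 1)" by (simp add: exp_minus divide_inverse)
    also have "\<dots> \<le> 1 / (1 + 2 * p 1)" using p1 by (intro divide_left_mono) auto
    also have "\<dots> \<le> 1 - p 1"
    proof -
      have "p 1 * (2 * p 1) \<le> p 1 * 1" using p1 p3 by (intro mult_left_mono) auto
      then show ?thesis using p1 by (simp add: field_simps)
    qed
    finally show ?thesis .
  qed
  then have "exp (- (2 * p 1)) ^ n \<le> (1 - p 1) ^ n" by (intro power_mono) auto
  also have "\<dots> \<le> (1 - p 1) ^ (n - a)" using p1 by (intro power_decreasing) auto
  finally have "exp (- (real n * (2 * p 1))) \<le> (1 - p 1) ^ (n - a)" by (simp flip: exp_of_nat_mult)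
  moreover have "exp (- L / 8) \<le> exp (- (real n * (2 * p 1)))" using pn by (simp add: mult.commute)
  ultimately have iso: "exp (- L / 8) \<le> (1 - p 1) ^ (n - a)" by linarith
  have "edge_prob r n p {\<omega>. percolates r ({1..n}, edges \<omega>)} \<le> real a ^ 2 * p 1 + (1 - (1 - p 1) ^ (n - a)) ^ a"
    by (rule edge_prob_percolates_le_isolated[OF p r an n(2)])
  also have "\<dots> \<le> sqrt (real n) * (L / real n) + exp (- (real a * exp (- L / 8)))"
  proof (rule add_mono)
    have "real a ^ 2 \<le> (real n powr (1 / 4)) ^ 2" using a by (intro power_mono) auto
    also have "\<dots> = sqrt (real n)" by (simp add: power2_eq_square powr_half_sqrt flip: powr_add)
    finally show "real a ^ 2 * p 1 \<le> sqrt (real n) * (L / real n)"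
      using p1 p2 n0 by (intro mult_mono) auto
    have "(1 - (1 - p 1) ^ (n - a)) ^ a \<le> (1 - exp (- L / 8)) ^ a"
      using iso p1 by (intro power_mono) (auto intro!: power_le_one)
    also have "\<dots> \<le> exp (- (real a * exp (- L / 8)))"
      using n by (intro one_minus_power_le_exp) (auto simp: L_def)
    finally show "(1 - (1 - p 1) ^ (n - a)) ^ a \<le> exp (- (real a * exp (- L / 8)))" .
  qed
  also have "\<dots> \<le> sqrt (real n) * (L / real n) + exp (- ((real n powr (1 / 4) - 1) * exp (- L / 8)))"
    using a by (intro add_left_mono) (simp add: mult_right_mono)
  finally show ?thesis by (simp add: L_def)
qed

text \<open>The error depends on \<open>n\<close> alone. Hence the colour index that witnesses the
  hypothesis may vary with \<open>n\<close>, and the errors of the two cases are simply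
  added.\<close>

lemma edge_prob_percolates_subcritical: "\<exists>\<epsilon>. \<epsilon> \<longlonglongrightarrow> 0 \<and> (\<forall>\<^sub>F n in sequentially. \<forall>p r (C :: real). p \<in> {1..r} \<rightarrow> {0..1} \<longrightarrow> 2 \<le> r \<longrightarrow> exp 5 * 4 ^ r \<le> C \<longrightarrow>
    (\<exists>i\<in>{2..r}. (\<Prod>s=1..i. p s) \<le> 1 / (C * real n * ln (real n) ^ (i - 1))) \<or> p 1 \<le> ln (real n) / (C * real n) \<longrightarrow>
    edge_prob r n p {\<omega>. percolates r ({1..n}, edges \<omega>)} \<le> \<epsilon> n)"
proof (intro exI conjI)
  let ?\<epsilon> = "\<lambda>n. exp 5 / real n ^ 2 + (sqrt (real n) * ln (real n) / real n +
    exp (- ((real n powr (1 / 4) - 1) * exp (- ln (real n) / 8))))"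
  show "?\<epsilon> \<longlonglongrightarrow> 0" by real_asymp
  have "\<forall>\<^sub>F n in sequentially. 2 \<le> ln (real n)" "\<forall>\<^sub>F n in sequentially. ln (real n) + 1 < real n"
    by real_asymp+
  then show "\<forall>\<^sub>F n in sequentially. \<forall>p r (C :: real). p \<in> {1..r} \<rightarrow> {0..1} \<longrightarrow> 2 \<le> r \<longrightarrow> exp 5 * 4 ^ r \<le> C \<longrightarrow>
    (\<exists>i\<in>{2..r}. (\<Prod>s=1..i. p s) \<le> 1 / (C * real n * ln (real n) ^ (i - 1))) \<or> p 1 \<le> ln (real n) / (C * real n) \<longrightarrow>
    edge_prob r n p {\<omega>. percolates r ({1..n}, edges \<omega>)} \<le> ?\<epsilon> n"
  proof eventually_elim
    case (elim n)
    show ?case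
    proof (intro allI impI)
      fix p :: "nat \<Rightarrow> real" and r and C :: real
      assume p: "p \<in> {1..r} \<rightarrow> {0..1}" and r: "2 \<le> r" and C: "exp 5 * 4 ^ r \<le> C"
      assume "(\<exists>i\<in>{2..r}. (\<Prod>s=1..i. p s) \<le> 1 / (C * real n * ln (real n) ^ (i - 1))) \<or> p 1 \<le> ln (real n) / (C * real n)"
      then consider i where "i \<in> {2..r}" "(\<Prod>s=1..i. p s) \<le> 1 / (C * real n * ln (real n) ^ (i - 1))"
        | "p 1 \<le> ln (real n) / (C * real n)" by blast
      then show "edge_prob r n p {\<omega>. percolates r ({1..n}, edges \<omega>)} \<le> ?\<epsilon> n"
      proof cases
        case 1
        have "nat \<lceil>ln (real n)\<rceil> < n" "2 \<le> nat \<lceil>ln (real n)\<rceil>" using elim by linarith+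
        then have "edge_prob r n p {\<omega>. percolates r ({1..n}, edges \<omega>)} \<le> exp 5 / real n ^ 2"
          using elim by (intro edge_prob_percolates_le_connected[OF p 1(1) _ _ _ C 1(2)]) auto
        moreover have "0 \<le> sqrt (real n) * ln (real n) / real n" using elim by simp
        moreover have "0 \<le> exp (- ((real n powr (1 / 4) - 1) * exp (- ln (real n) / 8)))" by simp
        ultimately show ?thesis by linarith
      next
        case 2
        have "(16 :: real) \<le> 1 * 4 ^ 2" by simp
        also have "\<dots> \<le> exp 5 * 4 ^ r" using r by (intro mult_mono power_increasing) auto
        finally have "16 \<le> C" using C by simp
        then have "edge_prob r n p {\<omega>. percolates r ({1..n}, edges \<omega>)} \<le>
          sqrt (real n) * ln (real n) / real n + exp (- ((real n powr (1 / 4) - 1) * exp (- ln (real n) / 8)))"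
          using elim r by (intro edge_prob_percolates_le_sparse[OF p _ _ _ _ _ 2]) auto
        moreover have "0 \<le> exp 5 / real n ^ 2" by simp
        ultimately show ?thesis by linarith
      qed
    qed
  qed
qed

section \<open>The supercritical regime\<close>

text \<open>For an increasing sequence truncation at 1 affects only a final segment. With
  \<open>a j = k * p j\<close> the remaining prefix is k^i P_i, which is how the hypotheses on
  prefix products control all colours at once.\<close>

lemma prod_min_1_eq_prefix:
  fixes a :: "nat \<Rightarrow> real"
  assumes "\<And>j. j \<in> {1..r} \<Longrightarrow> 0 \<le> a j" and "\<And>i j. i \<in> {1..r} \<Longrightarrow> j \<in> {1..r} \<Longrightarrow> i \<le> j \<Longrightarrow> a i \<le> a j"
  shows "\<exists>i\<le>r. (\<Prod>j=1..r. min 1 (a j)) = (\<Prod>j=1..i. a j)"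
  using assms
proof (induction r)
  case (Suc r)
  show ?case
  proof (cases "a (Suc r) \<le> 1")
    case True
    then have "min 1 (a j) = a j" if "j \<in> {1..Suc r}" for j
      using Suc.prems(2)[of j "Suc r"] that by auto
    then have "(\<Prod>j=1..Suc r. min 1 (a j)) = (\<Prod>j=1..Suc r. a j)" by (intro prod.cong) auto
    then show ?thesis by blast
  next
    case False
    have "\<exists>i\<le>r. (\<Prod>j=1..r. min 1 (a j)) = (\<Prod>j=1..i. a j)"
      by (rule Suc.IH) (use Suc.prems in auto)
    then obtain i where i: "i \<le> r" "(\<Prod>j=1..r. min 1 (a j)) = (\<Prod>j=1..i. a j)" by blast
    with False show ?thesis by (intro exI[of _ i]) (simp add: min_def)
  qed
qed simp

text \<open>With x = k p_s each factor is at least 1 - exp (- x) \<ge> x / (1 + x) \<ge> min 1 x /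
  2.\<close>

lemma join_prob_ge:
  assumes p: "p \<in> {1..r} \<rightarrow> {0..1}"
  shows "(1 / 2) ^ r * (\<Prod>s=1..r. min 1 (real k * p s)) \<le> join_prob r p k"
proof -
  have "(1 / 2) ^ r * (\<Prod>s=1..r. min 1 (real k * p s)) = (\<Prod>s=1..r. 1 / 2 * min 1 (real k * p s))"
    by (subst prod.distrib) simp
  also have "\<dots> \<le> join_prob r p k"
    unfolding join_prob_def
  proof (intro prod_mono conjI)
    fix s assume "s \<in> {1..r}"
    with p have "p s \<in> {0..1}" by (rule funcset_mem)
    then have ps: "0 \<le> p s" "p s \<le> 1" by auto
    define x where "x = real k * p s"
    have x: "0 \<le> x" using ps by (simp add: x_def)
    have "(1 - p s) ^ k \<le> exp (- x)" unfolding x_def by (rule one_minus_power_le_exp) (rule ps)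
    also have "\<dots> \<le> 1 / (1 + x)"
      using x by (simp add: exp_minus inverse_eq_divide frac_le add_pos_nonneg)
    also have "\<dots> \<le> 1 - 1 / 2 * min 1 x"
      using x by (cases "x \<le> 1") (auto simp: field_simps mult_left_le)
    finally show "1 / 2 * min 1 (real k * p s) \<le> 1 - (1 - p s) ^ k" by (simp add: x_def)
    show "0 \<le> 1 / 2 * min 1 (real k * p s)" using x by (simp add: x_def)
  qed
  finally show ?thesis .
qed

text \<open>A union bound over the colours that fail. It covers the range where joining is almost
  certain and the lower bound with its factor 2^(-r) says too little.\<close>

lemma one_minus_join_prob_le:
  assumes p: "p \<in> {1..r} \<rightarrow> {0..1}" and mono: "\<And>s. s \<in> {1..r} \<Longrightarrow> q \<le> p s" and q: "0 \<le> q"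
  shows "1 - join_prob r p k \<le> real r * exp (- (real k * q))"
proof -
  have "1 - (\<Sum>s=1..r. (1 - p s) ^ k) \<le> join_prob r p k"
    unfolding join_prob_def
    by (rule Weierstrass_prod_ineq) (use p in \<open>auto simp: Pi_iff intro!: power_le_one\<close>)
  moreover have "(\<Sum>s=1..r. (1 - p s) ^ k) \<le> (\<Sum>s=1..r. exp (- (real k * q)))"
  proof (rule sum_mono)
    fix s assume s: "s \<in> {1..r}"
    have "p s \<in> {0..1}" using p s by (rule funcset_mem)
    then have "(1 - p s) ^ k \<le> exp (- (real k * p s))" by (intro one_minus_power_le_exp) auto
    also have "\<dots> \<le> exp (- (real k * q))" using mono[OF s] by (simp add: mult_left_mono)
    finally show "(1 - p s) ^ k \<le> exp (- (real k * q))" .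
  qed
  ultimately show ?thesis by simp
qed

text \<open>Success probabilities are written as exponentials so that their product over a chain
  becomes a sum of exponents; here 1 - 1 / (1 + u) = 1 / (1 + 1 / u).\<close>

lemma one_minus_exp_neg_ge_late:
  fixes x u :: real
  assumes "0 < u" "1 + u \<le> exp x"
  shows "exp (- (1 / u)) \<le> 1 - exp (- x)"
proof -
  have "exp (- (1 / u)) \<le> 1 / (1 + 1 / u)"
    using assms by (simp add: exp_minus inverse_eq_divide frac_le add_pos_pos)
  also have "\<dots> = 1 - 1 / (1 + u)" using assms by (simp add: field_simps)
  also have "\<dots> \<le> 1 - exp (- x)"
    using assms by (simp add: exp_minus inverse_eq_divide frac_le)
  finally show ?thesis .
qed

text \<open>The square root is essential: for y proportional to k / L, exponents of order 1 / y
  would add up to about L ln L over k \<le> L, while those of order sqrt (1 / y) add up to O(L). It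
  comes from 1 + z^2 \<le> (1 + z)^2 \<le> exp (2 z).\<close>

lemma one_minus_exp_neg_ge_early:
  fixes x y :: real
  assumes r: "0 < r" and y: "0 < y" and x: "y ^ r \<le> x"
  shows "exp (- (2 * real r * sqrt (1 / y))) \<le> 1 - exp (- x)"
proof -
  define z where "z = sqrt (1 / y)"
  have z: "0 \<le> z" "z\<^sup>2 = 1 / y" using y by (auto simp: z_def)
  have yr: "0 < y ^ r" using y by simp
  then have x0: "0 < x" using x by linarith
  have "1 + 1 / y ^ r \<le> (1 + 1 / y) ^ r"
    using r
  proof (induction r rule: nat_induct_non_zero)
    case (Suc r)
    have "1 + 1 / y ^ Suc r \<le> (1 + 1 / y) * (1 + 1 / y ^ r)"
      using y by (simp add: field_simps)
    also have "\<dots> \<le> (1 + 1 / y) * (1 + 1 / y) ^ r"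
      using Suc y by (intro mult_left_mono) auto
    finally show ?case by simp
  qed simp
  moreover have "(1 + 1 / y) ^ r \<le> exp (2 * real r * z)"
  proof -
    have "1 + 1 / y \<le> (1 + z) ^ 2" using z by (simp add: power2_eq_square algebra_simps)
    also have "\<dots> \<le> exp z ^ 2" using z by (intro power_mono) auto
    finally have "(1 + 1 / y) ^ r \<le> (exp z ^ 2) ^ r" using y by (intro power_mono) auto
    also have "\<dots> = exp (2 * real r * z)" by (simp flip: exp_of_nat_mult power_mult)
    finally show ?thesis .
  qed
  ultimately have r0: "1 + 1 / y ^ r \<le> exp (2 * real r * z)" by linarith
  have "exp (- (2 * real r * z)) \<le> 1 / (1 + 1 / y ^ r)"
    using r0 yr by (simp add: exp_minus inverse_eq_divide frac_le add_pos_pos)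
  also have "\<dots> = 1 - 1 / (1 + y ^ r)"
  proof -
    have "1 / (1 + 1 / u) = 1 - 1 / (1 + u)" if "0 < u" for u :: real
      using that by (simp add: field_simps)
    then show ?thesis using yr by blast
  qed
  also have "\<dots> \<le> 1 - 1 / (1 + x)" using yr x x0 by (intro diff_left_mono divide_left_mono) auto
  also have "\<dots> \<le> 1 - exp (- x)"
    using x0 by (simp add: exp_minus inverse_eq_divide frac_le)
  finally show ?thesis by (simp add: z_def)
qed

text \<open>Applied to \<open>w\<close> of order sqrt (k / L), the fourth power yields (k / L)^2,
  whose inverse is summable beyond L.\<close>

lemma power4_le_exp:
  fixes w :: real
  assumes "0 \<le> w"
  shows "1 + (w / 4) ^ 4 \<le> exp w"
proof -
  have "(1 + y) ^ 4 = 1 + y ^ 4 + y * (4 + 6 * y + 4 * y ^ 2)" for y :: real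
    by (simp add: power4_eq_xxxx power2_eq_square algebra_simps)
  then have "1 + (w / 4) ^ 4 \<le> (1 + w / 4) ^ 4" using assms by simp
  also have "\<dots> \<le> exp (w / 4) ^ 4" using assms by (intro power_mono) auto
  also have "\<dots> = exp w" by (simp flip: exp_of_nat_mult)
  finally show ?thesis .
qed

section \<open>Sums of the step exponents\<close>

lemma sum_inverse_sqrt_le:
  fixes L :: real
  assumes "0 \<le> L"
  shows "(\<Sum>k=1..D. if real k \<le> L then 1 / sqrt (real k) else 0) \<le> 2 * sqrt L"
proof -
  have "(\<Sum>k=1..D. if real k \<le> L then 1 / sqrt (real k) else 0) \<le> 2 * sqrt (min (real D) L)"
  proof (induction D)
    case (Suc D)
    show ?case
    proof (cases "real (Suc D) \<le> L")
      case True
      define u v where "u = sqrt (real D)" and "v = sqrt (real (Suc D))"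
      have uv: "0 \<le> u" "0 < v" "v ^ 2 = u ^ 2 + 1" by (auto simp: u_def v_def)
      \<comment> \<open>This square gives the telescoping bound 1 / v \<le> 2 v - 2 u.\<close>
      have "0 \<le> (v - u) ^ 2" by simp
      then have "2 * u * v + 1 \<le> 2 * v ^ 2" using uv(3) by (simp add: power2_eq_square algebra_simps)
      then have "2 * u + 1 / v \<le> 2 * v" using uv by (simp add: field_simps power2_eq_square)
      then show ?thesis using Suc True by (simp add: u_def v_def min_def)
    next
      case False
      have "2 * sqrt (min (real D) L) \<le> 2 * sqrt L" by simp
      then have "(\<Sum>k=1..D. if real k \<le> L then 1 / sqrt (real k) else 0) \<le> 2 * sqrt L"
        using Suc by linarith
      then show ?thesis using False by simp
    qed
  qed (use assms in simp)
  also have "\<dots> \<le> 2 * sqrt L" by simp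
  finally show ?thesis .
qed

lemma sum_inverse_square_le:
  fixes L :: real
  assumes L: "0 < L"
  shows "(\<Sum>k=1..D. if real k \<le> L then 0 else 1 / (real k)\<^sup>2) \<le> 2 / L"
proof -
  \<comment> \<open>The remainder \<open>- 1 / real D\<close> makes the induction telescope. The
    first term beyond \<open>L\<close> has no predecessor and is bounded by 1 / L, whence the
    2.\<close>
  have "(\<Sum>k=1..D. if real k \<le> L then 0 else 1 / (real k)\<^sup>2) \<le> (if real D \<le> L then 0 else 2 / L - 1 / real D)"
  proof (induction D)
    case (Suc D)
    consider "real (Suc D) \<le> L" | "real D \<le> L" "L < real (Suc D)" | "L < real D" by linarith
    then show ?case
    proof cases
      case 1
      then show ?thesis using Suc by simp
    next
      case 2
      have "1 / (real (Suc D))\<^sup>2 \<le> 1 / real (Suc D)"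
        by (intro divide_left_mono) (auto simp: power2_eq_square)
      also have "1 / real (Suc D) \<le> 1 / L" using 2 L by (intro divide_left_mono) auto
      finally have "1 / (real (Suc D))\<^sup>2 \<le> 1 / L" .
      moreover have "1 / real (Suc D) \<le> 1 / L" using 2 L by (intro divide_left_mono) auto
      ultimately have "1 / (real (Suc D))\<^sup>2 \<le> 2 / L - 1 / real (Suc D)" by simp
      then show ?thesis using Suc 2 by simp
    next
      case 3
      then have D: "0 < real D" using L by linarith
      have "1 / (real (Suc D))\<^sup>2 \<le> 1 / (real D * real (Suc D))"
        using D by (intro divide_left_mono) (auto simp: power2_eq_square)
      also have "\<dots> = 1 / real D - 1 / real (Suc D)" using D by (simp add: field_simps)
      finally show ?thesis using Suc 3 by simp
    qed
  qed (use L in simp)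
  also have "\<dots> \<le> 2 / L" using L by simp
  finally show ?thesis .
qed

text \<open>\<open>C\<close> has its least admissible value, as the lower bounds on \<open>p\<close>
  weaken when \<open>C\<close> shrinks. Of its factors, 24 pays for the block sizes, 2^r for the
  loss in \<open>join_prob_ge\<close>, and the rest, called \<open>a\<close> below, for the step
  exponents. The conditions on \<open>n\<close> keep C L^3 / n at most 1 and make room for the
  trials in every block.\<close>

locale supercritical =
  fixes r n :: nat and p :: "nat \<Rightarrow> real" and C L :: real
  defines "L \<equiv> ln (real n)"
    and "C \<equiv> 24 * (2048 * real r ^ 2) ^ r"
  assumes r: "1 \<le> r"
    and p: "p \<in> {1..r} \<rightarrow> {0..1}"
    and p_mono: "\<And>i j. i \<in> {1..r} \<Longrightarrow> j \<in> {1..r} \<Longrightarrow> i \<le> j \<Longrightarrow> p i \<le> p j"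
    and p_1: "C * L / real n \<le> p 1"
    and p_prod: "\<And>i. i \<in> {2..r} \<Longrightarrow> C / (real n * L ^ (i - 1)) \<le> (\<Prod>j=1..i. p j)"
    and L_ge: "1 \<le> L"
    and n_ge: "C * L ^ 3 \<le> real n" "2 + sqrt (real n) \<le> real n / (24 * L ^ 3)"
begin

definition a :: real where "a = (1024 * real r ^ 2) ^ r"

definition \<mu> :: "nat \<Rightarrow> real" where "\<mu> k = (\<Prod>s=1..r. min 1 (real k * p s))"

lemma n_pos: "0 < real n"
  using L_ge by (cases "n = 0") (auto simp: L_def)

lemma exp_L: "exp L = real n"
  using n_pos by (simp add: L_def)

lemma C_eq: "C = 24 * 2 ^ r * a"
proof -
  have "(2048 * real r ^ 2) ^ r = (2 * (1024 * real r ^ 2)) ^ r" by simp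
  also have "\<dots> = 2 ^ r * a" unfolding a_def by (rule power_mult_distrib)
  finally show ?thesis by (simp add: C_def)
qed

lemma r_pos: "1 \<le> real r" "1 \<le> real r ^ 2" "real r \<le> real r ^ 2"
proof -
  show r1: "1 \<le> real r" using r by simp
  then show "real r \<le> real r ^ 2" using mult_left_mono[of 1 "real r" "real r"] by (simp add: power2_eq_square)
  then show "1 \<le> real r ^ 2" using r1 by linarith
qed

lemma a_ge: "1024 * real r ^ 2 \<le> a" "1024 \<le> a" "1024 * real r \<le> a"
proof -
  have "(1024 * real r ^ 2) ^ 1 \<le> a"
    unfolding a_def
  proof (rule power_increasing)
    show "1 \<le> 1024 * real r ^ 2" using r_pos by linarith
  qed (rule r)
  then show "1024 * real r ^ 2 \<le> a" "1024 \<le> a" "1024 * real r \<le> a"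
    using r_pos unfolding power_one_right by linarith+
qed

lemma C_ge: "12 * real r * 2 ^ r \<le> C" "12 \<le> C" "4 * real r \<le> C" "0 < C"
proof -
  have "24 * 2 ^ r * (1024 * real r) \<le> C"
    unfolding C_eq using a_ge by (intro mult_left_mono) auto
  moreover have "1 * real r \<le> 2 ^ r * real r" by (intro mult_right_mono) auto
  ultimately have "24576 * (2 ^ r * real r) \<le> C" "real r \<le> 2 ^ r * real r" by (auto simp: algebra_simps)
  then have "12 * (2 ^ r * real r) \<le> C" "12 \<le> C" "4 * real r \<le> C" "0 < C"
    using r_pos by linarith+
  then show "12 * real r * 2 ^ r \<le> C" "12 \<le> C" "4 * real r \<le> C" "0 < C"
    by (simp_all add: mult_ac)
qed

lemma L_le_L2: "L \<le> L ^ 2" "1 \<le> L ^ 2"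
proof -
  show "L \<le> L ^ 2" using mult_left_mono[of 1 L L] L_ge by (simp add: power2_eq_square)
  then show "1 \<le> L ^ 2" using L_ge by linarith
qed

lemma CL2_le: "C * L / real n * L ^ 2 \<le> 1" "C * L / real n \<le> 1"
proof -
  show *: "C * L / real n * L ^ 2 \<le> 1"
    using n_ge(1) n_pos by (simp add: field_simps power_eq_if)
  have "C * L / real n * 1 \<le> C * L / real n * L ^ 2"
    using L_ge C_ge n_pos by (intro mult_left_mono) auto
  with * show "C * L / real n \<le> 1" by simp
qed

text \<open>The cases are the lengths 0, 1 and at least 2 of the untruncated prefix. For length 1
  the bound is better by a factor L than the pattern of the others, because of the logarithm in
  \<open>p_1\<close>.\<close>

lemma \<mu>_cases:
  assumes "1 \<le> k"
  obtains "\<mu> k = 1" | "C * L / real n * real k \<le> \<mu> k"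
    | i where "i \<in> {2..r}" "C * L / real n * (real k / L) ^ i \<le> \<mu> k"
proof -
  have "\<exists>i\<le>r. \<mu> k = (\<Prod>j=1..i. real k * p j)"
    unfolding \<mu>_def
  proof (rule prod_min_1_eq_prefix)
    show "0 \<le> real k * p j" if "j \<in> {1..r}" for j
      using funcset_mem[OF p that] by simp
  qed (use p_mono in \<open>auto intro: mult_left_mono\<close>)
  then obtain i where i: "i \<le> r" "\<mu> k = real k ^ i * (\<Prod>j=1..i. p j)"
    by (auto simp: prod.distrib)
  consider "i = 0" | "i = 1" | "2 \<le> i" by linarith
  then show thesis
  proof cases
    case 1
    then show ?thesis using i that(1) by simp
  next
    case 2
    then have "\<mu> k = real k * p 1" using i by simp
    moreover have "real k * (C * L / real n) \<le> real k * p 1" using p_1 by (intro mult_left_mono) auto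
    ultimately show ?thesis using that(2) by (simp add: mult.commute)
  next
    case 3
    then have ir: "i \<in> {2..r}" using i by simp
    have "real k ^ i * (C / (real n * L ^ (i - 1))) \<le> \<mu> k"
      unfolding i(2) by (intro mult_left_mono p_prod ir) auto
    moreover have "C * L / real n * (real k / L) ^ i = real k ^ i * (C / (real n * L ^ (i - 1)))"
      using ir L_ge by (simp add: power_divide power_eq_if[of L i] divide_simps)
    ultimately show ?thesis using that(3) ir by simp
  qed
qed

text \<open>As k / L \<le> 1, the largest exponent \<open>r\<close> is the worst.\<close>

lemma \<mu>_early:
  assumes "1 \<le> k" "real k \<le> L"
  shows "C * L / real n * (real k / L) ^ r \<le> \<mu> k"
proof -
  have CL: "0 \<le> C * L / real n" using C_ge L_ge by simp
  have kL: "0 \<le> real k / L" "real k / L \<le> 1" using assms L_ge by auto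
  have le1: "(real k / L) ^ r \<le> 1" using kL by (rule power_le_one)
  from assms(1) show ?thesis
  proof (cases rule: \<mu>_cases)
    case 1
    have "C * L / real n * (real k / L) ^ r \<le> 1 * 1"
      using CL2_le le1 CL kL by (intro mult_mono) auto
    with 1 show ?thesis by simp
  next
    case 2
    have "C * L / real n * (real k / L) ^ r \<le> C * L / real n * real k"
      using le1 assms CL by (intro mult_left_mono) auto
    with 2 show ?thesis by simp
  next
    case (3 i)
    have "C * L / real n * (real k / L) ^ r \<le> C * L / real n * (real k / L) ^ i"
      using 3 kL CL by (intro mult_left_mono power_decreasing) auto
    with 3 show ?thesis by simp
  qed
qed

text \<open>As k / L \<ge> 1, the smallest exponent 2 is the worst. The linear case is no smaller,
  because (k / L)^2 \<le> k exactly up to k = L^2.\<close>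

lemma \<mu>_middle:
  assumes "1 \<le> k" "L \<le> real k" "real k \<le> L ^ 2"
  shows "C * L / real n * (real k / L) ^ 2 \<le> \<mu> k"
proof -
  have CL: "0 \<le> C * L / real n" using C_ge L_ge by simp
  have kL: "1 \<le> real k / L" "real k / L \<le> L" using assms L_ge by (auto simp: field_simps power2_eq_square)
  from assms(1) show ?thesis
  proof (cases rule: \<mu>_cases)
    case 1
    have "C * L / real n * (real k / L) ^ 2 \<le> C * L / real n * L ^ 2"
      using kL CL by (intro mult_left_mono power_mono) auto
    with 1 CL2_le show ?thesis by simp
  next
    case 2
    have "(real k / L) ^ 2 = real k * (real k / L ^ 2)" by (simp add: power2_eq_square)
    also have "\<dots> \<le> real k * 1" using assms L_ge by (intro mult_left_mono) auto
    finally have "C * L / real n * (real k / L) ^ 2 \<le> C * L / real n * real k"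
      using CL by (intro mult_left_mono) auto
    with 2 show ?thesis by simp
  next
    case (3 i)
    have "C * L / real n * (real k / L) ^ 2 \<le> C * L / real n * (real k / L) ^ i"
      using 3 kL CL by (intro mult_left_mono power_increasing) auto
    with 3 show ?thesis by simp
  qed
qed

text \<open>Beyond L^2 the comparison is reversed, k \<le> (k / L)^2, and the linear bound is the
  worst.\<close>

lemma \<mu>_late:
  assumes "1 \<le> k" "L ^ 2 \<le> real k"
  shows "min 1 (C * L / real n * real k) \<le> \<mu> k"
proof -
  have CL: "0 \<le> C * L / real n" using C_ge L_ge by simp
  have "L \<le> real k" using L_le_L2 assms by linarith
  then have kL: "1 \<le> real k / L" using L_ge by simp
  from assms(1) show ?thesis
  proof (cases rule: \<mu>_cases)
    case (3 i)
    have "real k * L ^ 2 \<le> real k * real k" using assms by (intro mult_left_mono) auto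
    then have "real k \<le> (real k / L) ^ 2" using L_ge by (simp add: power2_eq_square field_simps)
    also have "\<dots> \<le> (real k / L) ^ i" using 3 kL by (intro power_increasing) auto
    finally have "C * L / real n * real k \<le> C * L / real n * (real k / L) ^ i"
      using CL by (intro mult_left_mono) auto
    with 3 show ?thesis by simp
  qed auto
qed

lemma join_prob_ge_\<mu>: "(1 / 2) ^ r * \<mu> k \<le> join_prob r p k"
  unfolding \<mu>_def by (rule join_prob_ge[OF p])

text \<open>
  The number of candidates for the next vertex of a chain of size \<open>k\<close> decays like \<open>k powr (- 3 / 2)\<close>:
  this is summable, so that the blocks fit into the vertex set, while the expected number of
  successful candidates grows like \<open>sqrt (k / L)\<close> for \<open>k \<ge> L\<close>, so that a chain of size \<open>L\<close> is likely
  to extend to size \<open>L\<^sup>2\<close>.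
\<close>

definition cut :: "nat \<Rightarrow> nat" where
  "cut k = nat \<lfloor>real n * (1 - sqrt L / sqrt (L + real k))\<rfloor>"

definition block :: "nat \<Rightarrow> nat set" where
  "block k = {cut k<..cut (Suc k)}"

lemma cut_mono: "mono cut"
proof (rule monoI)
  fix i j :: nat assume "i \<le> j"
  then have "sqrt L / sqrt (L + real j) \<le> sqrt L / sqrt (L + real i)"
    using L_ge by (intro divide_left_mono mult_pos_pos) auto
  then show "cut i \<le> cut j"
    unfolding cut_def using n_pos by (intro nat_mono floor_mono mult_left_mono) auto
qed

lemma cut_le: "cut k \<le> n"
proof -
  have "real n * (1 - sqrt L / sqrt (L + real k)) \<le> real n * 1"
    using L_ge by (intro mult_left_mono) auto
  then show ?thesis unfolding cut_def by linarith
qed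

lemma disjoint_family_block: "disjoint_family block"
proof -
  have "block i \<inter> block j = {}" if "i < j" for i j
  proof -
    have "cut (Suc i) \<le> cut j" using that by (intro monoD[OF cut_mono]) simp
    then show ?thesis by (auto simp: block_def)
  qed
  then show ?thesis unfolding disjoint_family_on_def by (metis Int_commute linorder_neqE_nat)
qed

lemma block_subset: "block k \<subseteq> {1..n}"
  using cut_le[of "Suc k"] by (auto simp: block_def)

text \<open>A block is an increment of the function rounded in \<open>cut\<close>, and 1 / u - 1 / v
  = 1 / (u v (u + v)) for consecutive square roots; rounding costs 1. The free \<open>y\<close>
  replaces L + k by the dominant term: L for early steps, k for late ones.\<close>

lemma card_block_ge:
  assumes y: "L + real k + 1 \<le> 3 * y" "0 < y"
  shows "real n * sqrt L / (12 * (y * sqrt y)) - 1 \<le> real (card (block k))"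
proof -
  define x where "x = L + real k"
  define u v where "u = sqrt x" and "v = sqrt (x + 1)"
  have x: "1 \<le> x" using L_ge by (simp add: x_def)
  have uv: "0 < u" "0 < v" "u \<le> v" "u * u = x" "v * v = x + 1" using x by (auto simp: u_def v_def)
  have xy: "x + 1 \<le> 3 * y" using y by (simp add: x_def)
  have "v \<le> sqrt (4 * y)" unfolding v_def using xy y by simp
  then have vy: "v \<le> 2 * sqrt y" by (simp add: real_sqrt_mult)
  have "u * v * (u + v) \<le> v * v * (v + v)" using uv by (intro mult_mono) auto
  also have "\<dots> = 2 * (x + 1) * v" using uv by (simp add: algebra_simps)
  also have "\<dots> \<le> 2 * (3 * y) * (2 * sqrt y)" using xy x vy uv by (intro mult_mono) auto
  finally have den: "u * v * (u + v) \<le> 12 * (y * sqrt y)" by simp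
  have "1 / (12 * (y * sqrt y)) \<le> 1 / (u * v * (u + v))"
    using den uv y by (intro divide_left_mono) auto
  also have "\<dots> = 1 / u - 1 / v"
  proof -
    have "(v - u) * (u + v) = 1" using uv(4,5) by (simp add: algebra_simps)
    then have "1 / (u * v * (u + v)) = (v - u) * (u + v) / (u * v * (u + v))" by simp
    also have "\<dots> = (v - u) / (u * v)" using uv by simp
    also have "\<dots> = 1 / u - 1 / v" using uv by (simp add: diff_divide_distrib)
    finally show ?thesis .
  qed
  finally have "real n * sqrt L * (1 / (12 * (y * sqrt y))) \<le> real n * sqrt L * (1 / u - 1 / v)"
    using L_ge by (intro mult_left_mono) auto
  then have main: "real n * sqrt L / (12 * (y * sqrt y)) \<le>
    real n * (1 - sqrt L / v) - real n * (1 - sqrt L / u)" by (simp add: algebra_simps)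
  have "sqrt L \<le> u" "sqrt L \<le> v" unfolding u_def v_def x_def using L_ge by auto
  then have "0 \<le> real n * (1 - sqrt L / v)" "0 \<le> real n * (1 - sqrt L / u)" using uv by auto
  moreover have "cut k = nat \<lfloor>real n * (1 - sqrt L / u)\<rfloor>" by (simp add: cut_def u_def x_def)
  moreover have "cut (Suc k) = nat \<lfloor>real n * (1 - sqrt L / v)\<rfloor>" by (simp add: cut_def v_def x_def add.commute add.left_commute)
  ultimately have "real n * (1 - sqrt L / v) - 1 \<le> real (cut (Suc k))" "real (cut k) \<le> real n * (1 - sqrt L / u)"
    by linarith+
  moreover have "cut k \<le> cut (Suc k)" by (rule monoD[OF cut_mono]) simp
  ultimately show ?thesis using main by (simp add: block_def of_nat_diff)
qed

text \<open>Large against n^(1/4), the inverse of the success probability of a trial, and small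
  against n / L^3, the scale of the last blocks.\<close>

definition trials :: nat where "trials = nat \<lfloor>sqrt (real n)\<rfloor>"

text \<open>The candidates left in block \<open>k\<close> at every trial, after one vertex per trial
  has been reserved.\<close>

definition size :: "nat \<Rightarrow> nat" where "size k = card (block k) - trials"

lemma trials: "real trials \<le> sqrt (real n)" "sqrt (real n) - 1 \<le> real trials"
  by (auto simp: trials_def)

text \<open>\<open>card_block_ge\<close> gives twice the claimed quantity, up to 1. For
  \<open>y \<le> L ^ 2\<close> the quantity is at least 2 + sqrt n, so its second copy pays for the
  trials and the rounding.\<close>

lemma size_ge:
  assumes k: "real k < L ^ 2"
  shows "size k + trials \<le> card (block k)"
    and "L + real k + 1 \<le> 3 * y \<Longrightarrow> 0 < y \<Longrightarrow> y \<le> L ^ 2 \<Longrightarrow>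
      real n * sqrt L / (24 * (y * sqrt y)) \<le> real (size k)"
proof -
  have main: "trials \<le> card (block k) \<and> real n * sqrt L / (24 * (y * sqrt y)) \<le> real (size k)"
    if y: "L + real k + 1 \<le> 3 * y" "0 < y" "y \<le> L ^ 2" for y
  proof -
    have "sqrt y \<le> L" using y L_ge by (simp add: real_le_lsqrt)
    then have "y * sqrt y \<le> L ^ 2 * L" using y L_ge by (intro mult_mono) auto
    then have le: "24 * (y * sqrt y) \<le> 24 * L ^ 3" by (simp add: power_eq_if)
    have "2 + sqrt (real n) \<le> real n * 1 / (24 * L ^ 3)" using n_ge by simp
    also have "\<dots> \<le> real n * sqrt L / (24 * (y * sqrt y))"
      using le y L_ge by (intro frac_le mult_left_mono) auto
    finally have "2 + sqrt (real n) \<le> real n * sqrt L / (24 * (y * sqrt y))" .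
    moreover have "real n * sqrt L / (12 * (y * sqrt y)) = 2 * (real n * sqrt L / (24 * (y * sqrt y)))" by simp
    ultimately show ?thesis
      using card_block_ge[OF y(1,2)] trials unfolding size_def by linarith
  qed
  have "L + real k + 1 \<le> 3 * L ^ 2" using k L_le_L2 by linarith
  then have "trials \<le> card (block k)" using main[of "L ^ 2"] L_le_L2 by linarith
  then show "size k + trials \<le> card (block k)" by (simp add: size_def)
  show "L + real k + 1 \<le> 3 * y \<Longrightarrow> 0 < y \<Longrightarrow> y \<le> L ^ 2 \<Longrightarrow>
      real n * sqrt L / (24 * (y * sqrt y)) \<le> real (size k)" using main by blast
qed

definition step_prob :: "nat \<Rightarrow> real" where
  "step_prob k = 1 - (1 - join_prob r p k) ^ size k"

lemma step_prob_bounds: "0 \<le> step_prob k" "step_prob k \<le> 1"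
  using join_prob_bounds[OF p, of k] by (auto simp: step_prob_def power_le_one)

lemma step_prob_ge:
  assumes "x \<le> real (size k) * ((1 / 2) ^ r * \<mu> k)"
  shows "1 - exp (- x) \<le> step_prob k"
proof -
  have "x \<le> real (size k) * join_prob r p k"
    using assms mult_left_mono[OF join_prob_ge_\<mu>[of k], of "real (size k)"] by linarith
  then show ?thesis
    using one_minus_power_le_exp[OF join_prob_bounds(2)[OF p], of k "size k"]
    unfolding step_prob_def by (smt (verit) exp_le_cancel_iff)
qed

text \<open>With at least n / (24 L) candidates, \<open>y ^ r\<close> is a lower bound for the
  expected number of joined ones. The factor 1024 = 32^2 in \<open>y\<close> makes 2 r sqrt (1 / y)
  equal to sqrt (L / k) / 16.\<close>

lemma step_prob_early:
  assumes k: "1 \<le> k" "real k \<le> L" "real k < L ^ 2"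
  shows "exp (- (sqrt L / 16 * (1 / sqrt (real k)))) \<le> step_prob k"
proof -
  define y where "y = 1024 * real r ^ 2 * (real k / L)"
  have y: "0 < y" using k L_ge r by (simp add: y_def)
  have "real n * sqrt L / (24 * (L * sqrt L)) \<le> real (size k)" using k L_ge L_le_L2 by (intro size_ge) auto
  then have size: "real n / (24 * L) \<le> real (size k)" using L_ge by simp
  have "y ^ r = a * (real k / L) ^ r" by (simp only: y_def a_def power_mult_distrib)
  also have "\<dots> = real n / (24 * L) * ((1 / 2) ^ r * (C * L / real n * (real k / L) ^ r))"
    unfolding C_eq using L_ge n_pos by (simp add: field_simps)
  also have "\<dots> \<le> real (size k) * ((1 / 2) ^ r * \<mu> k)"
    using size \<mu>_early[OF k(1,2)] L_ge C_ge by (intro mult_mono) auto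
  finally have "1 - exp (- (y ^ r)) \<le> step_prob k" by (rule step_prob_ge)
  moreover have "exp (- (2 * real r * sqrt (1 / y))) \<le> 1 - exp (- (y ^ r))"
    by (rule one_minus_exp_neg_ge_early) (use r y in auto)
  moreover have "2 * real r * sqrt (1 / y) = sqrt L / 16 * (1 / sqrt (real k))"
  proof -
    have "sqrt 1024 = (32 :: real)" by (rule real_sqrt_unique) auto
    then show ?thesis using r by (simp add: y_def real_sqrt_mult real_sqrt_divide)
  qed
  ultimately show ?thesis by simp
qed

text \<open>At least n / (24 k z) candidates with z = sqrt (k / L) yield 1024 z joined ones in
  expectation, and exp (1024 z) exceeds (256 z)^4, which is a large multiple of (k / L)^2.\<close>

lemma step_prob_late:
  assumes k: "1 \<le> k" "L < real k" "real k < L ^ 2"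
  shows "exp (- (L ^ 2 / 16 * (1 / real k ^ 2))) \<le> step_prob k"
proof -
  define z where "z = sqrt (real k / L)"
  have z: "0 < z" "z ^ 2 = real k / L" using k L_ge by (auto simp: z_def)
  define w where "w = 1024 * z"
  have "real n * sqrt L / (24 * (real k * sqrt (real k))) \<le> real (size k)" using k L_ge by (intro size_ge) auto
  moreover have "real n * sqrt L / (24 * (real k * sqrt (real k))) = real n / (24 * real k) * (sqrt L / sqrt (real k))"
    by simp
  moreover have "sqrt L / sqrt (real k) = 1 / z" by (simp add: z_def real_sqrt_divide)
  ultimately have size: "real n / (24 * (real k * z)) \<le> real (size k)"
    by (simp add: mult.assoc)
  have "w \<le> a * z" unfolding w_def using a_ge z by (intro mult_right_mono) auto
  also have "\<dots> = real n / (24 * (real k * z)) * ((1 / 2) ^ r * (C * L / real n * (real k / L) ^ 2))"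
  proof -
    have "a * z = a * z ^ 2 / z" using z(1) by (simp add: power2_eq_square)
    then show ?thesis
      unfolding C_eq z(2) using L_ge n_pos k z(1) by (simp add: field_simps power2_eq_square)
  qed
  also have "\<dots> \<le> real (size k) * ((1 / 2) ^ r * \<mu> k)"
    using size \<mu>_middle[of k] k L_ge C_ge z by (intro mult_mono) auto
  finally have "1 - exp (- w) \<le> step_prob k" by (rule step_prob_ge)
  moreover have "exp (- (1 / (16 * (real k / L) ^ 2))) \<le> 1 - exp (- w)"
  proof (rule one_minus_exp_neg_ge_late)
    show "0 < 16 * (real k / L) ^ 2" using k L_ge by simp
    have "(w / 4) ^ 4 = 256 ^ 4 * (z ^ 2) ^ 2" by (simp add: w_def power_mult_distrib)
    also have "\<dots> = 256 ^ 4 * (real k / L) ^ 2" by (simp only: z(2))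
    finally have "16 * (real k / L) ^ 2 \<le> (w / 4) ^ 4" by simp
    moreover have "1 + (w / 4) ^ 4 \<le> exp w" using z by (intro power4_le_exp) (simp add: w_def)
    ultimately show "1 + 16 * (real k / L) ^ 2 \<le> exp w" by linarith
  qed
  moreover have "1 / (16 * (real k / L) ^ 2) = L ^ 2 / 16 * (1 / real k ^ 2)"
    by (simp add: power_divide)
  ultimately show ?thesis by simp
qed

text \<open>The steps up to L and those beyond L each contribute L / 8 to the exponent.\<close>

lemma prod_step_prob_ge:
  assumes D: "real D < L ^ 2"
  shows "exp (- (L / 4)) \<le> (\<Prod>k=1..D. step_prob k)"
proof -
  let ?s = "\<lambda>k. if real k \<le> L then 1 / sqrt (real k) else 0"
  let ?t = "\<lambda>k. if real k \<le> L then 0 else 1 / (real k)\<^sup>2"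
  have "(\<Sum>k=1..D. sqrt L / 16 * ?s k + L ^ 2 / 16 * ?t k) =
    sqrt L / 16 * (\<Sum>k=1..D. ?s k) + L ^ 2 / 16 * (\<Sum>k=1..D. ?t k)"
    by (simp only: sum.distrib sum_distrib_left)
  also have "\<dots> \<le> sqrt L / 16 * (2 * sqrt L) + L ^ 2 / 16 * (2 / L)"
    using L_ge by (intro add_mono mult_left_mono sum_inverse_sqrt_le sum_inverse_square_le) auto
  also have "\<dots> = L / 4" using L_ge by (simp add: power2_eq_square)
  finally have "exp (- (L / 4)) \<le> exp (- (\<Sum>k=1..D. sqrt L / 16 * ?s k + L ^ 2 / 16 * ?t k))" by simp
  also have "\<dots> = (\<Prod>k=1..D. exp (- (sqrt L / 16 * ?s k + L ^ 2 / 16 * ?t k)))"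
    by (simp only: exp_sum[symmetric] sum_negf finite_atLeastAtMost)
  also have "\<dots> \<le> (\<Prod>k=1..D. step_prob k)"
  proof (intro prod_mono conjI)
    fix k assume k: "k \<in> {1..D}"
    then have "1 \<le> k" "real k < L ^ 2" using D by auto
    then show "exp (- (sqrt L / 16 * ?s k + L ^ 2 / 16 * ?t k)) \<le> step_prob k"
      using step_prob_early[of k] step_prob_late[of k] by (cases "real k \<le> L") auto
  qed simp
  finally show ?thesis .
qed

text \<open>At most n terms are summed, so n^(-2) per term is enough. The exponent L k of the number
  of sets, or L (n - k) if the complement is smaller, has to be beaten three times over by that of
  the joining failures.\<close>

lemma stuck_term_le:
  assumes k: "L ^ 2 \<le> real k" "k < n"
  shows "real (n choose k) * (1 - join_prob r p k) ^ (n - k) \<le> exp (- (2 * L))"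
proof -
  define f where "f = join_prob r p k"
  define y where "y = C * L / real n * real k"
  have f: "0 \<le> f" "f \<le> 1" unfolding f_def by (rule join_prob_bounds[OF p])+
  have k1: "1 \<le> k" using k L_le_L2 by (cases k) auto
  have yn: "y * real n = C * L * real k" using n_pos by (simp add: y_def)
  have y0: "0 < y" using C_ge L_ge n_pos k1 by (simp add: y_def)
  have choose1: "real (n choose k) \<le> exp (L * real k)"
  proof -
    have "real (n choose k) \<le> real n ^ k"
      using binomial_le_pow[of k n] k by (metis less_imp_le of_nat_le_iff of_nat_power)
    also have "\<dots> = exp (L * real k)" by (simp add: exp_of_nat2_mult exp_L)
    finally show ?thesis .
  qed
  have choose2: "real (n choose k) \<le> exp (L * real (n - k))"
  proof -
    have "n choose k = n choose (n - k)" using k by (intro binomial_symmetric) simp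
    then have "real (n choose k) \<le> real n ^ (n - k)"
      using binomial_le_pow[of "n - k" n] by (metis diff_le_self of_nat_le_iff of_nat_power)
    also have "\<dots> = exp (L * real (n - k))" by (simp add: exp_of_nat2_mult exp_L)
    finally show ?thesis .
  qed
  \<comment> \<open>For \<open>2 * real r \<le> y\<close> half of the exponent absorbs the number of
    colours: r \<le> exp (y / 2).\<close>
  have dense: "1 - f \<le> exp (- (y / 2))" if "2 * real r \<le> y"
  proof -
    have "C * L / real n * real k \<le> p 1 * real k" using p_1 by (intro mult_right_mono) auto
    then have y: "y \<le> real k * p 1" by (simp add: y_def mult.commute)
    have "0 \<le> p 1" using p r by (auto simp: Pi_iff)
    then have "1 - f \<le> real r * exp (- (real k * p 1))"
      unfolding f_def using r p_mono by (intro one_minus_join_prob_le[OF p]) auto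
    also have "\<dots> \<le> exp (y / 2) * exp (- y)"
    proof (rule mult_mono)
      have "real r \<le> exp (real r)" using exp_ge_add_one_self[of "real r"] by linarith
      also have "\<dots> \<le> exp (y / 2)" using that by simp
      finally show "real r \<le> exp (y / 2)" .
    qed (use y in auto)
    also have "\<dots> = exp (- (y / 2))" by (simp flip: exp_add)
    finally show ?thesis .
  qed
  show ?thesis
  proof (cases "real n \<le> 2 * real k")
    case True
    have "C * L * 1 \<le> 2 * y"
    proof -
      have "C * L * real n \<le> C * L * (2 * real k)" using True C_ge L_ge by (intro mult_left_mono) auto
      then have "C * L * real n \<le> 2 * y * real n" using yn by simp
      then show ?thesis using n_pos by simp
    qed
    moreover have "C * 1 \<le> C * L" using C_ge L_ge by (intro mult_left_mono) auto
    ultimately have "2 * real r \<le> y" and yL: "C * L \<le> 2 * y" using C_ge by linarith+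
    have m: "1 \<le> real (n - k)" using k by simp
    have "12 * L \<le> C * L" using C_ge L_ge by (intro mult_right_mono) auto
    then have "3 * L \<le> y / 2" using yL by linarith
    then have y3: "real (n - k) * (3 * L) \<le> real (n - k) * (y / 2)" by (intro mult_left_mono) auto
    have "(1 - f) ^ (n - k) \<le> exp (- (y / 2)) ^ (n - k)"
      using dense[OF \<open>2 * real r \<le> y\<close>] f by (intro power_mono) auto
    also have "\<dots> = exp (- (real (n - k) * (y / 2)))" by (simp flip: exp_of_nat_mult)
    also have "\<dots> \<le> exp (- (real (n - k) * (3 * L)))" using y3 by simp
    finally have "real (n choose k) * (1 - f) ^ (n - k) \<le> exp (L * real (n - k)) * exp (- (real (n - k) * (3 * L)))"
      using choose2 f by (intro mult_mono) auto
    also have "\<dots> = exp (- (2 * (real (n - k) * L)))" by (simp flip: exp_add)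
    also have "\<dots> \<le> exp (- (2 * L))" using mult_right_mono[OF m, of L] L_ge by simp
    finally show ?thesis by (simp only: f_def)
  next
    case False
    then have m: "real n / 2 \<le> real (n - k)" using k by simp
    have "(1 - f) ^ (n - k) \<le> exp (- (3 * (L * real k)))"
    proof (cases "2 * real r \<le> y")
      case True
      have "(1 - f) ^ (n - k) \<le> exp (- (y / 2)) ^ (n - k)"
        using dense[OF True] f by (intro power_mono) auto
      also have "\<dots> = exp (- (real (n - k) * (y / 2)))" by (simp flip: exp_of_nat_mult)
      also have "\<dots> \<le> exp (- (real n / 2 * (y / 2)))"
        using mult_right_mono[OF m, of "y / 2"] y0 by simp
      also have "\<dots> = exp (- (C * L * real k / 4))" using yn by (simp add: mult.commute)
      also have "\<dots> \<le> exp (- (3 * (L * real k)))"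
        using mult_right_mono[OF C_ge(2), of "L * real k"] L_ge by simp
      finally show ?thesis .
    next
      case False
      \<comment> \<open>In the sparse range the truncation at 1 is replaced by a bound linear in y,
        so that the exponent stays proportional to L k.\<close>
      have "y / (2 * real r) \<le> min 1 y"
      proof -
        have "y / (2 * real r) \<le> y / 1" using y0 r_pos by (intro divide_left_mono) auto
        moreover have "y / (2 * real r) \<le> 1" using False r_pos by simp
        ultimately show ?thesis by simp
      qed
      also have "\<dots> \<le> \<mu> k" unfolding y_def by (rule \<mu>_late[OF k1 k(1)])
      finally have "(1 / 2) ^ r * (y / (2 * real r)) \<le> (1 / 2) ^ r * \<mu> k" by (intro mult_left_mono) auto
      also have "\<dots> \<le> f" unfolding f_def by (rule join_prob_ge_\<mu>)
      finally have "real n / 2 * ((1 / 2) ^ r * (y / (2 * real r))) \<le> real (n - k) * f"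
        using m f y0 by (intro mult_mono) auto
      moreover have "real n / 2 * ((1 / 2) ^ r * (y / (2 * real r))) = C * (L * real k) / (4 * real r * 2 ^ r)"
        using yn r_pos by (simp add: power_divide field_simps)
      moreover have "3 * (L * real k) \<le> C * (L * real k) / (4 * real r * 2 ^ r)"
        using mult_right_mono[OF C_ge(1), of "L * real k"] L_ge r_pos by (simp add: field_simps)
      ultimately have "3 * (L * real k) \<le> real (n - k) * f" by linarith
      then show ?thesis using one_minus_power_le_exp[OF f(2), of "n - k"] by (smt (verit) exp_le_cancel_iff)
    qed
    then have "real (n choose k) * (1 - f) ^ (n - k) \<le> exp (L * real k) * exp (- (3 * (L * real k)))"
      using choose1 f by (intro mult_mono) auto
    also have "\<dots> = exp (- (2 * (L * real k)))" by (simp flip: exp_add)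
    also have "\<dots> \<le> exp (- (2 * L))" using mult_left_mono[of 1 "real k" L] k1 L_ge by simp
    finally show ?thesis by (simp only: f_def)
  qed
qed

lemma edge_prob_not_percolates:
  "edge_prob r n p {\<omega>. \<not> percolates r ({1..n}, edges \<omega>)} \<le>
    exp (- ((sqrt (real n) - 1) * exp (- (L / 4)))) + 1 / real n"
proof -
  \<comment> \<open>The rounding is chosen so that all steps \<open>k \<le> D\<close> lie strictly
    below L^2, while the finished chain of \<open>Suc D\<close> vertices has at least L^2.\<close>
  define D where "D = nat \<lceil>L ^ 2\<rceil> - 1"
  have "1 \<le> nat \<lceil>L ^ 2\<rceil>" using L_le_L2 by linarith
  then have SD: "Suc D = nat \<lceil>L ^ 2\<rceil>" by (simp add: D_def)
  then have D: "real D < L ^ 2" "L ^ 2 \<le> real (Suc D)" by linarith+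
  define q where "q = (\<Prod>k=1..D. step_prob k)"
  have q: "exp (- (L / 4)) \<le> q" "q \<le> 1"
    unfolding q_def using prod_step_prob_ge[OF D(1)] step_prob_bounds by (auto intro!: prod_le_1)
  have "edge_prob r n p {\<omega>. \<not> percolates r ({1..n}, edges \<omega>)} \<le>
    (1 - (\<Prod>k=1..D. 1 - (1 - join_prob r p k) ^ size k)) ^ trials +
    (\<Sum>k=Suc D..<n. real (n choose k) * (1 - join_prob r p k) ^ (n - k))"
  proof (rule edge_prob_not_percolates_le[OF p disjoint_family_block block_subset])
    fix i assume "i \<le> D"
    then have "real i < L ^ 2" using D by (meson le_less_trans of_nat_le_iff)
    then show "size i + trials \<le> card (block i)" by (rule size_ge)
  qed
  also have "(1 - (\<Prod>k=1..D. 1 - (1 - join_prob r p k) ^ size k)) ^ trials = (1 - q) ^ trials"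
    by (simp add: q_def step_prob_def)
  also have "(1 - q) ^ trials \<le> exp (- (real trials * q))" by (rule one_minus_power_le_exp[OF q(2)])
  also have "\<dots> \<le> exp (- ((sqrt (real n) - 1) * exp (- (L / 4))))"
  proof -
    have "(sqrt (real n) - 1) * exp (- (L / 4)) \<le> real trials * exp (- (L / 4))"
      using trials by (intro mult_right_mono) auto
    also have "\<dots> \<le> real trials * q" using q by (intro mult_left_mono) auto
    finally show ?thesis by simp
  qed
  also have "(\<Sum>k=Suc D..<n. real (n choose k) * (1 - join_prob r p k) ^ (n - k)) \<le> (\<Sum>k=Suc D..<n. exp (- (2 * L)))"
  proof (rule sum_mono)
    fix k assume "k \<in> {Suc D..<n}"
    then have "real (Suc D) \<le> real k" "k < n" by auto
    then show "real (n choose k) * (1 - join_prob r p k) ^ (n - k) \<le> exp (- (2 * L))"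
      using D(2) by (intro stuck_term_le) linarith+
  qed
  also have "\<dots> \<le> real n * exp (- (2 * L))" by simp
  also have "real n * exp (- (2 * L)) = 1 / real n"
  proof -
    have "exp (2 * L) = real n * real n" using exp_L by (metis exp_add mult_2)
    then show ?thesis using n_pos by (simp add: exp_minus divide_inverse)
  qed
  finally show ?thesis by simp
qed

end

text \<open>The error and the threshold for \<open>n\<close> depend on \<open>r\<close> but not on
  \<open>p\<close>; any larger \<open>C\<close> is reduced to the constant of the locale, since its
  hypotheses are stronger.\<close>

lemma edge_prob_percolates_supercritical:
  assumes r: "2 \<le> r"
  shows "\<exists>\<epsilon>. \<epsilon> \<longlonglongrightarrow> 0 \<and> (\<forall>\<^sub>F n in sequentially. \<forall>p (C :: real). p \<in> {1..r} \<rightarrow> {0..1} \<longrightarrow>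
    (\<forall>i j. i \<in> {1..r} \<longrightarrow> j \<in> {1..r} \<longrightarrow> i \<le> j \<longrightarrow> p i \<le> p j) \<longrightarrow> 24 * (2048 * real r ^ 2) ^ r \<le> C \<longrightarrow>
    (\<forall>i\<in>{2..r}. C / (real n * ln (real n) ^ (i - 1)) \<le> (\<Prod>s=1..i. p s)) \<and> C * ln (real n) / real n \<le> p 1 \<longrightarrow>
    edge_prob r n p {\<omega>. \<not> percolates r ({1..n}, edges \<omega>)} \<le> \<epsilon> n)"
proof (intro exI conjI)
  let ?\<epsilon> = "\<lambda>n. exp (- ((sqrt (real n) - 1) * exp (- (ln (real n) / 4)))) + 1 / real n"
  define C0 where "C0 = 24 * (2048 * real r ^ 2) ^ r"
  show "?\<epsilon> \<longlonglongrightarrow> 0" by real_asymp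
  have "\<forall>\<^sub>F n in sequentially. 1 \<le> ln (real n)" "\<forall>\<^sub>F n in sequentially. C0 * ln (real n) ^ 3 \<le> real n"
    "\<forall>\<^sub>F n in sequentially. 2 + sqrt (real n) \<le> real n / (24 * ln (real n) ^ 3)"
    by real_asymp+
  then show "\<forall>\<^sub>F n in sequentially. \<forall>p (C :: real). p \<in> {1..r} \<rightarrow> {0..1} \<longrightarrow>
    (\<forall>i j. i \<in> {1..r} \<longrightarrow> j \<in> {1..r} \<longrightarrow> i \<le> j \<longrightarrow> p i \<le> p j) \<longrightarrow> 24 * (2048 * real r ^ 2) ^ r \<le> C \<longrightarrow>
    (\<forall>i\<in>{2..r}. C / (real n * ln (real n) ^ (i - 1)) \<le> (\<Prod>s=1..i. p s)) \<and> C * ln (real n) / real n \<le> p 1 \<longrightarrow>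
    edge_prob r n p {\<omega>. \<not> percolates r ({1..n}, edges \<omega>)} \<le> ?\<epsilon> n"
  proof eventually_elim
    case (elim n)
    show ?case
    proof (intro allI impI, elim conjE)
      fix p :: "nat \<Rightarrow> real" and C :: real
      assume p: "p \<in> {1..r} \<rightarrow> {0..1}"
        and p_mono: "\<forall>i j. i \<in> {1..r} \<longrightarrow> j \<in> {1..r} \<longrightarrow> i \<le> j \<longrightarrow> p i \<le> p j"
        and C: "24 * (2048 * real r ^ 2) ^ r \<le> C"
        and P: "\<forall>i\<in>{2..r}. C / (real n * ln (real n) ^ (i - 1)) \<le> (\<Prod>s=1..i. p s)"
        and P1: "C * ln (real n) / real n \<le> p 1"
      have "supercritical r n p"
      proof
        show "24 * (2048 * real r ^ 2) ^ r * ln (real n) / real n \<le> p 1"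
        proof -
          have "24 * (2048 * real r ^ 2) ^ r * ln (real n) / real n \<le> C * ln (real n) / real n"
            using C elim(1) by (intro divide_right_mono mult_right_mono) auto
          with P1 show ?thesis by linarith
        qed
        show "24 * (2048 * real r ^ 2) ^ r / (real n * ln (real n) ^ (i - 1)) \<le> (\<Prod>j=1..i. p j)"
          if "i \<in> {2..r}" for i
        proof -
          have "24 * (2048 * real r ^ 2) ^ r / (real n * ln (real n) ^ (i - 1)) \<le> C / (real n * ln (real n) ^ (i - 1))"
            using C elim(1) by (intro divide_right_mono) auto
          with P that show ?thesis by fastforce
        qed
      qed (use r p p_mono elim in \<open>auto simp: C0_def\<close>)
      then show "edge_prob r n p {\<omega>. \<not> percolates r ({1..n}, edges \<omega>)} \<le> ?\<epsilon> n"
        by (rule supercritical.edge_prob_not_percolates)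
    qed
  qed
qed

theorem theorem2:
  fixes r :: nat
  assumes "r \<ge> 2"
  shows "\<exists>C::real. C > 0 \<and>
    (\<forall>p :: nat \<Rightarrow> nat \<Rightarrow> real.
      (\<forall>n. 0 \<le> p 1 n \<and> (\<forall>i\<in>{1..<r}. p i n \<le> p (Suc i) n) \<and> p r n \<le> 1) \<longrightarrow>
      (let P = (\<lambda>i n. \<Prod>j=1..i. p j n) in
        ((\<forall>\<^sub>F n in sequentially.
            (\<exists>i\<in>{2..r}. P i n \<le> 1 / (C * real n * ln (real n) ^ (i - 1))) \<or>
            P 1 n \<le> ln (real n) / (C * real n))
          \<longrightarrow> (\<lambda>n. measure_pmf.prob (fold_gnp r n (\<lambda>i. p i n)) {G. \<not> percolates r G})
                \<longlonglongrightarrow> 1) \<and>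
        ((\<forall>\<^sub>F n in sequentially.
            (\<forall>i\<in>{2..r}. P i n \<ge> C / (real n * ln (real n) ^ (i - 1))) \<and>
            P 1 n \<ge> C * ln (real n) / real n)
          \<longrightarrow> (\<lambda>n. measure_pmf.prob (fold_gnp r n (\<lambda>i. p i n)) {G. percolates r G})
                \<longlonglongrightarrow> 1)))"
proof -
  \<comment> \<open>Each half holds for all constants above its own threshold, so the maximum serves
    both.\<close>
  define C where "C = max (exp 5 * 4 ^ r) (24 * (2048 * real r ^ 2) ^ r)"
  have C: "0 < C" "exp 5 * 4 ^ r \<le> C" "24 * (2048 * real r ^ 2) ^ r \<le> C"
    by (auto simp: C_def less_max_iff_disj)
  obtain \<epsilon> where \<epsilon>: "\<epsilon> \<longlonglongrightarrow> 0" and sub: "\<forall>\<^sub>F n in sequentially. \<forall>p r (C :: real). p \<in> {1..r} \<rightarrow> {0..1} \<longrightarrow> 2 \<le> r \<longrightarrow> exp 5 * 4 ^ r \<le> C \<longrightarrow>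
    (\<exists>i\<in>{2..r}. (\<Prod>s=1..i. p s) \<le> 1 / (C * real n * ln (real n) ^ (i - 1))) \<or> p 1 \<le> ln (real n) / (C * real n) \<longrightarrow>
    edge_prob r n p {\<omega>. percolates r ({1..n}, edges \<omega>)} \<le> \<epsilon> n"
    using edge_prob_percolates_subcritical by blast
  obtain \<delta> where \<delta>: "\<delta> \<longlonglongrightarrow> 0" and super: "\<forall>\<^sub>F n in sequentially. \<forall>p (C :: real). p \<in> {1..r} \<rightarrow> {0..1} \<longrightarrow>
    (\<forall>i j. i \<in> {1..r} \<longrightarrow> j \<in> {1..r} \<longrightarrow> i \<le> j \<longrightarrow> p i \<le> p j) \<longrightarrow> 24 * (2048 * real r ^ 2) ^ r \<le> C \<longrightarrow>
    (\<forall>i\<in>{2..r}. C / (real n * ln (real n) ^ (i - 1)) \<le> (\<Prod>s=1..i. p s)) \<and> C * ln (real n) / real n \<le> p 1 \<longrightarrow>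
    edge_prob r n p {\<omega>. \<not> percolates r ({1..n}, edges \<omega>)} \<le> \<delta> n"
    using edge_prob_percolates_supercritical[OF assms] by blast
  \<comment> \<open>The probability is squeezed between 1 minus the error bound and 1.\<close>
  have whp: "(\<lambda>n. measure_pmf.prob (fold_gnp r n (\<lambda>i. p i n)) {G. Q G}) \<longlonglongrightarrow> 1"
    if "\<eta> \<longlonglongrightarrow> 0" and "\<forall>\<^sub>F n in sequentially. edge_prob r n (\<lambda>i. p i n) {\<omega>. \<not> Q ({1..n}, edges \<omega>)} \<le> \<eta> n"
    for p :: "nat \<Rightarrow> nat \<Rightarrow> real" and Q and \<eta> :: "nat \<Rightarrow> real"
  proof (rule tendsto_sandwich)
    show "(\<lambda>n. 1 - \<eta> n) \<longlonglongrightarrow> 1" using tendsto_diff[OF tendsto_const that(1), of 1] by simp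
    show "\<forall>\<^sub>F n in sequentially. 1 - \<eta> n \<le> measure_pmf.prob (fold_gnp r n (\<lambda>i. p i n)) {G. Q G}"
      using that(2) by eventually_elim (simp add: prob_fold_gnp edge_prob_compl)
  qed auto
  show ?thesis
  proof (intro exI[of _ C] conjI C(1) allI impI)
    fix p :: "nat \<Rightarrow> nat \<Rightarrow> real"
    assume p: "\<forall>n. 0 \<le> p 1 n \<and> (\<forall>i\<in>{1..<r}. p i n \<le> p (Suc i) n) \<and> p r n \<le> 1"
    have mono: "p i n \<le> p j n" if "i \<in> {1..r}" "j \<in> {1..r}" "i \<le> j" for i j n
    proof -
      have "j \<le> r \<longrightarrow> p i n \<le> p j n" using \<open>i \<le> j\<close>
      proof (induction j rule: dec_induct)
        case (step m)
        have "p m n \<le> p (Suc m) n" if "Suc m \<le> r" using p that step \<open>i \<in> {1..r}\<close> by auto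
        with step show ?case by auto
      qed simp
      with that show ?thesis by simp
    qed
    have range: "(\<lambda>i. p i n) \<in> {1..r} \<rightarrow> {0..1}" for n
    proof (rule funcsetI)
      fix i assume i: "i \<in> {1..r}"
      have "0 \<le> p 1 n" "p 1 n \<le> p i n" "p i n \<le> p r n" "p r n \<le> 1"
        using p mono[of 1 i n] mono[of i r n] i by auto
      then show "p i n \<in> {0..1}" by simp
    qed
    show "let P = (\<lambda>i n. \<Prod>j=1..i. p j n) in
        ((\<forall>\<^sub>F n in sequentially.
            (\<exists>i\<in>{2..r}. P i n \<le> 1 / (C * real n * ln (real n) ^ (i - 1))) \<or>
            P 1 n \<le> ln (real n) / (C * real n))
          \<longrightarrow> (\<lambda>n. measure_pmf.prob (fold_gnp r n (\<lambda>i. p i n)) {G. \<not> percolates r G})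
                \<longlonglongrightarrow> 1) \<and>
        ((\<forall>\<^sub>F n in sequentially.
            (\<forall>i\<in>{2..r}. P i n \<ge> C / (real n * ln (real n) ^ (i - 1))) \<and>
            P 1 n \<ge> C * ln (real n) / real n)
          \<longrightarrow> (\<lambda>n. measure_pmf.prob (fold_gnp r n (\<lambda>i. p i n)) {G. percolates r G})
                \<longlonglongrightarrow> 1)"
      unfolding Let_def
    proof (intro conjI impI)
      assume "\<forall>\<^sub>F n in sequentially.
            (\<exists>i\<in>{2..r}. (\<Prod>j=1..i. p j n) \<le> 1 / (C * real n * ln (real n) ^ (i - 1))) \<or>
            (\<Prod>j=1..1. p j n) \<le> ln (real n) / (C * real n)"
      with sub have "\<forall>\<^sub>F n in sequentially. edge_prob r n (\<lambda>i. p i n) {\<omega>. percolates r ({1..n}, edges \<omega>)} \<le> \<epsilon> n"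
      proof eventually_elim
        case (elim n)
        show ?case
          by (rule elim(1)[rule_format, OF range assms C(2)]) (use elim(2) in simp)
      qed
      then show "(\<lambda>n. measure_pmf.prob (fold_gnp r n (\<lambda>i. p i n)) {G. \<not> percolates r G}) \<longlonglongrightarrow> 1"
        by (intro whp[OF \<epsilon>]) simp
    next
      assume "\<forall>\<^sub>F n in sequentially.
            (\<forall>i\<in>{2..r}. (\<Prod>j=1..i. p j n) \<ge> C / (real n * ln (real n) ^ (i - 1))) \<and>
            (\<Prod>j=1..1. p j n) \<ge> C * ln (real n) / real n"
      with super have "\<forall>\<^sub>F n in sequentially. edge_prob r n (\<lambda>i. p i n) {\<omega>. \<not> percolates r ({1..n}, edges \<omega>)} \<le> \<delta> n"
      proof eventually_elim
        case (elim n)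
        show ?case
          by (rule elim(1)[rule_format, OF range mono C(3)]) (use elim(2) in auto)
      qed
      then show "(\<lambda>n. measure_pmf.prob (fold_gnp r n (\<lambda>i. p i n)) {G. percolates r G}) \<longlonglongrightarrow> 1"
        by (rule whp[OF \<delta>])
    qed
  qed
qed

end
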